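(* If $w$ is a noncrossing involution, then $w$ has an L-shaped soliton decomposition. More precisely, let $w$ be a noncrossing involution in $S_n$, let $c$ denote the number of adjacent $2$-cycles of $w$, and let $k$ denote the number of all $2$-cycles of $w$ (including the adjacent $2$-cycles). Then the shape of $\mathrm{SD}(w)$ is $(n-2k+c,\underbrace{1,1,\dots,1}_{2k-c\ \text{copies}})$.
   Context: Involutions: a pair of distinct $2$-cycles is a crossing if they can be written as $(ac)$ and $(bd)$ with $a<b<c<d$. An involution (the identity is allowed) is noncrossing if no pair of its $2$-cycles is a crossing. An adjacent $2$-cycle is one of the form $(i,i+1)$. Box-ball system (BBS). Boxes are indexed by $\mathbb{Z}$ from left to right. A BBS configuration (with $n$ balls) is a sequence $X$ indexed by $\mathbb{Z}$ in which each of $1,\dots,n$ (the balls) appears exactly once and every other entry is $e := n+1$ (an empty box). One BBS move transforms $X$ into $\mathrm{BB}(X)$: the balls $1,2,\dots,n$, in this order, each jump once, to the nearest box to the right of the ball that is empty at that moment (the box a ball leaves becomes empty). $\mathrm{BB}^t(X)$ is the result of $t$ BBS moves. A permutation $w = w_1\cdots w_n \in S_n$ (one-line notation) is regarded as the configuration with ball $w_i$ in box $i$ for $1\le i\le n$ and all other boxes empty. An increasing run of a configuration is a maximal contiguous (occupying consecutive boxes) increasing nonempty sequence of balls. A soliton is an increasing run that is preserved by all subsequent BBS moves (it remains an increasing run in all later configurations). A configuration is in steady state if every ball is contained in a soliton. Every box-ball system reaches steady state after finitely many moves, and then the sizes of the solitons weakly increase from left to right. The soliton decomposition $\mathrm{SD}(w)$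 is the tableau whose first (top) row is the rightmost soliton of a steady-state configuration $\mathrm{BB}^t(w)$, whose second row is the second rightmost soliton, and so on. It is L-shaped if its shape is of the form $(s,1,\dots,1)$ (with zero or more $1$'s). *)

theory Defs
  imports Main "HOL-Combinatorics.Permutations"
begin

section \<open>Noncrossing involutions\<close>

text \<open>Elements of \<open>S\<^sub>n\<close> are functions \<open>w\<close> on the naturals with \<open>w permutes {1..n}\<close>;
  a 2-cycle \<open>(a b)\<close> is represented by the unordered pair \<open>{a, b}\<close>.\<close>

definition involution :: "(nat \<Rightarrow> nat) \<Rightarrow> bool" where
  "involution w \<longleftrightarrow> w \<circ> w = id"

definition two_cycles :: "(nat \<Rightarrow> nat) \<Rightarrow> nat set set" where
  "two_cycles w = {{a, b} | a b. a \<noteq> b \<and> w a = b \<and> w b = a}"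

definition crossing :: "nat set \<Rightarrow> nat set \<Rightarrow> bool" where
  "crossing C D \<longleftrightarrow> (\<exists>a b c d. a < b \<and> b < c \<and> c < d \<and> {C, D} = {{a, c}, {b, d}})"

definition noncrossing_involution :: "(nat \<Rightarrow> nat) \<Rightarrow> bool" where
  "noncrossing_involution w \<longleftrightarrow>
     involution w \<and> (\<forall>C\<in>two_cycles w. \<forall>D\<in>two_cycles w. \<not> crossing C D)"

definition adjacent :: "nat set \<Rightarrow> bool" where
  "adjacent C \<longleftrightarrow> (\<exists>i. C = {i, i + 1})"

section \<open>Box-ball systems\<close>

text \<open>A configuration with \<open>n\<close> balls is a function on the integers: \<open>X i\<close> is the ball in box \<open>i\<close>,
  and \<open>X i = n + 1\<close> means that box \<open>i\<close> is empty.\<close>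

type_synonym config = "int \<Rightarrow> nat"

definition config_of_perm :: "nat \<Rightarrow> (nat \<Rightarrow> nat) \<Rightarrow> config" where
  "config_of_perm n w = (\<lambda>i. if 1 \<le> i \<and> i \<le> int n then w (nat i) else n + 1)"

text \<open>The \<open>LEAST\<close> below ranges over the integers; it is meaningful because the candidates are
  bounded below by the current box of the ball, and there are only finitely many balls.\<close>

definition jump :: "nat \<Rightarrow> nat \<Rightarrow> config \<Rightarrow> config" where
  "jump n b X =
     (let i = (THE i. X i = b);
          j = (LEAST j. i < j \<and> X j = n + 1)
      in X(i := n + 1, j := b))"

definition BB :: "nat \<Rightarrow> config \<Rightarrow> config" where
  "BB n X = fold (jump n) [1..<n + 1] X"

text \<open>\<open>increasing_block n X p xs\<close>: the boxes \<open>p, p + 1, \<dots>\<close> contain the increasing nonempty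
  sequence of balls \<open>xs\<close>. A run is a block that is maximal with respect to the boxes it occupies.\<close>

definition increasing_block :: "nat \<Rightarrow> config \<Rightarrow> int \<Rightarrow> nat list \<Rightarrow> bool" where
  "increasing_block n X p xs \<longleftrightarrow>
     xs \<noteq> [] \<and> set xs \<subseteq> {1..n} \<and> sorted_wrt (<) xs \<and>
     (\<forall>j<length xs. X (p + int j) = xs ! j)"

definition increasing_run_at :: "nat \<Rightarrow> config \<Rightarrow> int \<Rightarrow> nat list \<Rightarrow> bool" where
  "increasing_run_at n X p xs \<longleftrightarrow>
     increasing_block n X p xs \<and>
     (\<forall>q ys. increasing_block n X q ys \<and>
        {p..<p + int (length xs)} \<subseteq> {q..<q + int (length ys)} \<longrightarrow> q = p \<and> ys = xs)"

definition increasing_run :: "nat \<Rightarrow> config \<Rightarrow> nat list \<Rightarrow> bool" where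
  "increasing_run n X xs \<longleftrightarrow> (\<exists>p. increasing_run_at n X p xs)"

text \<open>A soliton is identified with its sequence of balls; its boxes change with each move.\<close>

definition soliton :: "nat \<Rightarrow> config \<Rightarrow> nat list \<Rightarrow> bool" where
  "soliton n X xs \<longleftrightarrow> (\<forall>t. increasing_run n ((BB n ^^ t) X) xs)"

definition steady_state :: "nat \<Rightarrow> config \<Rightarrow> bool" where
  "steady_state n X \<longleftrightarrow> (\<forall>b\<in>{1..n}. \<exists>xs. soliton n X xs \<and> b \<in> set xs)"

section \<open>Soliton decompositions\<close>

text \<open>A tableau is the list of its rows, from top to bottom.\<close>

type_synonym tableau = "nat list list"

definition shape :: "tableau \<Rightarrow> nat list" where
  "shape T = map length T"

definition L_shaped :: "tableau \<Rightarrow> bool" where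
  "L_shaped T \<longleftrightarrow> (\<exists>s m. s \<ge> 1 \<and> shape T = s # replicate m 1)"

text \<open>\<open>solitons_right_to_left n X T\<close>: \<open>T\<close> lists all the solitons of \<open>X\<close>, each once, from the
  rightmost to the leftmost; \<open>ps\<close> are their (first) boxes.\<close>

definition solitons_right_to_left :: "nat \<Rightarrow> config \<Rightarrow> tableau \<Rightarrow> bool" where
  "solitons_right_to_left n X T \<longleftrightarrow>
     set T = {xs. soliton n X xs} \<and>
     (\<exists>ps. length ps = length T \<and> sorted_wrt (>) ps \<and>
        (\<forall>i<length T. increasing_run_at n X (ps ! i) (T ! i)))"

text \<open>\<open>SD(w)\<close> as a relation: it is read off from some steady-state configuration \<open>BB\<^sup>t(w)\<close>, without
  a preferred choice of \<open>t\<close>.\<close>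

definition is_SD :: "nat \<Rightarrow> (nat \<Rightarrow> nat) \<Rightarrow> tableau \<Rightarrow> bool" where
  "is_SD n w T \<longleftrightarrow>
     (\<exists>t. let X = (BB n ^^ t) (config_of_perm n w)
          in steady_state n X \<and> solitons_right_to_left n X T)"

end

theory Submission imports Defs begin

text \<open>
  Two facts about a permutation \<open>w\<close> pin down an L-shaped decomposition. If \<open>w\<close> has an increasing
  subsequence of length \<open>l\<close>, then the top row of the decomposition has length at least \<open>l\<close>. The
  number of rows is the number of increasing runs of \<open>w\<close>, that is, \<open>n\<close> minus the number of ascents.
  If \<open>w\<close> has fewer than \<open>l\<close> ascents, there are more than \<open>n - l\<close> rows, and since the row lengths add
  up to \<open>n\<close>, the top row must have length exactly \<open>l\<close> and all others length 1
  (\<open>SD_shape_of_long_increasing_subsequence\<close>). For a noncrossing involution take \<open>l = n - 2 k + c\<close>: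
  the fixed points together with the left ends of the adjacent 2-cycles form an increasing
  subsequence, while every 2-cycle \<open>(a b)\<close> with \<open>a < b\<close> forces a descent right after position \<open>a\<close> and one right
  before position \<open>b\<close>, and these coincide only for adjacent cycles; so there are at least
  \<open>2 k - c\<close> descents.

  Both facts come from describing one move by a carrier that sweeps over the boxes from left to
  right and holds the balls in flight, that is, those that have left their old box and have not yet
  reached their new one. At a box with content \<open>v\<close> the carrier drops its smallest ball larger than \<open>v\<close>
  (its smallest ball at all if the box is empty) and picks up \<open>v\<close>; this is Schensted row insertion
  (\<open>BB_sweep\<close>).

  The number of runs: a local analysis of two neighbouring boxes shows which descents appear
  after a move, and their number is unchanged (\<open>card_descents\<close>).

  The top row: beyond the last ball the carrier unloads everything it holds in increasing
  order, and this becomes the rightmost run of the next configuration. When this run is inserted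
  during the following move, none of its balls is ejected, so the content of the rightmost run can
  only grow (\<open>final_load_mono\<close>). In the first move the carrier reaches the end of \<open>w\<close> without
  meeting an empty box, and by Schensted's argument it then holds at least as many balls as any
  increasing subsequence of \<open>w\<close> (\<open>increasing_subsequence_load\<close>).

  Steady state: once the content of the rightmost run has stopped growing, every sweep
  leaves that run with exactly the balls it consists of. Inserting it then just ejects, in
  increasing order, whatever the carrier brought along, which is what empty boxes would
  do. Hence the other balls move as if that run were absent (\<open>sweep_remove\<close>), and
  induction on the number of balls shows that eventually no run changes any more
  (\<open>links_eventually_constant\<close>).
\<close>

section \<open>Arrangements of balls\<close>

text \<open>The set \<open>B\<close> of labels is a parameter because runs will be removed from a configuration, while
  \<open>n + 1\<close> goes on to denote an empty box.\<close>

definition arrangement :: "nat \<Rightarrow> nat set \<Rightarrow> config \<Rightarrow> bool" where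
  "arrangement n B X \<longleftrightarrow> B \<subseteq> {1..n} \<and> range X \<subseteq> insert (n + 1) B \<and> (\<forall>b\<in>B. \<exists>!i. X i = b)"

lemma arrangement_cases: "arrangement n B X \<Longrightarrow> X i = n + 1 \<or> X i \<in> B"
  unfolding arrangement_def by (metis insertE rangeI subsetD)

lemma arrangement_labels: "arrangement n B X \<Longrightarrow> B \<subseteq> {1..n}"
  by (simp add: arrangement_def)

lemma arrangement_ball: "arrangement n B X \<Longrightarrow> X i \<le> n \<Longrightarrow> X i \<in> B"
  using arrangement_cases[of n B X i] by auto

lemma arrangement_le: "arrangement n B X \<Longrightarrow> X i \<le> n + 1"
  using arrangement_cases[of n B X i] arrangement_labels[of n B X] by fastforce

lemma arrangement_inj: "arrangement n B X \<Longrightarrow> X i = X j \<Longrightarrow> X i \<le> n \<Longrightarrow> i = j"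
  using arrangement_ball[of n B X i] unfolding arrangement_def by metis

lemma arrangement_bij: "arrangement n B X \<Longrightarrow> bij_betw X {i. X i \<le> n} B"
  unfolding bij_betw_def
proof
  assume a: "arrangement n B X"
  show "inj_on X {i. X i \<le> n}" using arrangement_inj[OF a] by (auto intro: inj_onI)
  show "X ` {i. X i \<le> n} = B"
  proof
    show "X ` {i. X i \<le> n} \<subseteq> B" using arrangement_ball[OF a] by auto
    show "B \<subseteq> X ` {i. X i \<le> n}"
    proof
      fix b assume b: "b \<in> B"
      then obtain i where "X i = b" using a unfolding arrangement_def by blast
      moreover have "b \<le> n" using a b unfolding arrangement_def by auto
      ultimately show "b \<in> X ` {i. X i \<le> n}" by auto
    qed
  qed
qed

lemma arrangement_finite: "arrangement n B X \<Longrightarrow> finite {i. X i \<le> n}"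
  using arrangement_bij[of n B X] bij_betw_finite[of X "{i. X i \<le> n}" B]
  using arrangement_labels[of n B X] finite_subset by blast

lemma arrangement_relocate:
  assumes "arrangement n B X" "X i = b" "b \<in> B" "X j = n + 1"
  shows "arrangement n B (X(i := n + 1, j := b))"
proof -
  have "B \<subseteq> {1..n}" using assms(1) by (simp add: arrangement_def)
  hence bn: "b \<noteq> n + 1" "\<And>c. c \<in> B \<Longrightarrow> c \<noteq> n + 1" using assms(3) by auto
  have uniq: "\<exists>!k. X k = c" if "c \<in> B" for c using assms(1) that by (simp add: arrangement_def)
  have rng: "range X \<subseteq> insert (n + 1) B" using assms(1) by (simp add: arrangement_def)
  have "\<exists>!k. (X(i := n + 1, j := b)) k = c" if c: "c \<in> B" for c
  proof (cases "c = b")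
    case True
    have "k = j" if k: "(X(i := n + 1, j := b)) k = c" for k
    proof (rule ccontr)
      assume "k \<noteq> j"
      hence "k \<noteq> i" "X k = b" using k True bn(1) by (auto split: if_splits)
      with assms(2,3) \<open>B \<subseteq> {1..n}\<close> have "k = i" by (intro arrangement_inj[OF assms(1)]) auto
      with \<open>k \<noteq> i\<close> show False ..
    qed
    thus ?thesis using True by (intro ex1I[of _ j]) simp
  next
    case False
    obtain k where k: "X k = c" "\<And>k'. X k' = c \<Longrightarrow> k' = k" using uniq[OF c] by (elim ex1E) metis
    have "k \<noteq> i" "k \<noteq> j" using k(1) False assms(2,4) bn(2)[OF c] by auto
    hence at_k: "(X(i := n + 1, j := b)) k = c" using k(1) by simp
    have "k' = k" if "(X(i := n + 1, j := b)) k' = c" for k'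
    proof -
      have "X k' = c" using that False bn(2)[OF c] by (simp split: if_splits)
      thus ?thesis by (rule k(2))
    qed
    with at_k show ?thesis by (rule ex1I)
  qed
  moreover have "range (X(i := n + 1, j := b)) \<subseteq> insert (n + 1) B"
    using rng assms(3) by (intro image_subsetI) (simp add: image_subset_iff)
  moreover have "B \<subseteq> {1..n}" using assms(1) by (simp add: arrangement_def)
  ultimately show ?thesis unfolding arrangement_def by (intro conjI ballI)
qed

text \<open>Pairs of balls that are neighbours within one increasing run. They determine the runs, whatever
  boxes these occupy.\<close>

definition links :: "nat \<Rightarrow> config \<Rightarrow> (nat \<times> nat) set" where
  "links n X = {(a, b). a < b \<and> b \<le> n \<and> (\<exists>i. X i = a \<and> X (i + 1) = b)}"

definition descents :: "config \<Rightarrow> int set" where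
  "descents X = {i. X (i + 1) < X i}"

lemma card_ball_shift:
  assumes "arrangement n B X"
  shows "finite {i. X (i + 1) \<le> n}" "card {i. X i \<le> n} = card {i. X (i + 1) \<le> n}"
proof -
  have "{i. X (i + 1) \<le> n} = (\<lambda>i. i - 1) ` {i. X i \<le> n}"
  proof (intro set_eqI iffI)
    fix i assume "i \<in> {i. X (i + 1) \<le> n}"
    thus "i \<in> (\<lambda>i. i - 1) ` {i. X i \<le> n}" by (intro image_eqI[of _ _ "i + 1"]) auto
  qed auto
  moreover have "inj_on (\<lambda>i::int. i - 1) {i. X i \<le> n}" by (simp add: inj_on_def)
  ultimately show "finite {i. X (i + 1) \<le> n}" "card {i. X i \<le> n} = card {i. X (i + 1) \<le> n}"
    using arrangement_finite[OF assms] by (simp_all add: card_image)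
qed

text \<open>Look at the box to the left of each ball: it holds a smaller ball, which gives a link, or a larger
  ball or nothing, which gives a descent because an empty box counts as \<open>n + 1\<close>.\<close>

lemma card_links:
  assumes "arrangement n B X"
  shows "finite (links n X)" "card (links n X) + card (descents X) = card B"
proof -
  define A where "A = {i. X i < X (i + 1) \<and> X (i + 1) \<le> n}"
  have split: "{i. X (i + 1) \<le> n} = A \<union> descents X"
  proof (intro set_eqI)
    fix i
    have "X (i + 1) \<le> n \<Longrightarrow> X i \<noteq> X (i + 1)" using arrangement_inj[OF assms, of "i + 1" i] by auto
    thus "i \<in> {i. X (i + 1) \<le> n} \<longleftrightarrow> i \<in> A \<union> descents X"
      using arrangement_le[OF assms, of i] by (auto simp: A_def descents_def)
  qed
  have "links n X = (\<lambda>i. (X i, X (i + 1))) ` A" by (auto simp: links_def A_def)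
  moreover have "finite A"
    by (rule finite_subset[OF _ card_ball_shift(1)[OF assms]]) (auto simp: A_def)
  ultimately show "finite (links n X)" by simp
  have "inj_on (\<lambda>i. (X i, X (i + 1))) A"
  proof (intro inj_onI)
    fix i j assume "i \<in> A" "(X i, X (i + 1)) = (X j, X (j + 1))"
    hence "X (i + 1) = X (j + 1)" "X (i + 1) \<le> n" by (auto simp: A_def)
    thus "i = j" using arrangement_inj[OF assms] by fastforce
  qed
  with \<open>links n X = _\<close> have "card (links n X) = card A" by (simp add: card_image)
  also have "A \<inter> descents X = {}" by (auto simp: A_def descents_def)
  hence "card A + card (descents X) = card {i. X (i + 1) \<le> n}"
    using card_ball_shift(1)[OF assms] unfolding split by (simp add: card_Un_disjoint)
  also have "\<dots> = card B"
    using card_ball_shift(2)[OF assms] bij_betw_same_card[OF arrangement_bij[OF assms]] by simp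
  finally show "card (links n X) + card (descents X) = card B" by simp
qed

section \<open>One move as a carrier sweeping from left to right\<close>

text \<open>The content of the carrier when it leaves box \<open>p\<close>, read off from the configurations before and
  after the move.\<close>

definition in_flight :: "nat \<Rightarrow> config \<Rightarrow> config \<Rightarrow> int \<Rightarrow> nat set" where
  "in_flight n X X' p = {b. b \<le> n \<and> (\<exists>i\<le>p. X i = b) \<and> (\<exists>j>p. X' j = b)}"

lemma in_flightI: "X i = b \<Longrightarrow> i \<le> p \<Longrightarrow> X' j = b \<Longrightarrow> p < j \<Longrightarrow> b \<le> n \<Longrightarrow> b \<in> in_flight n X X' p"
  by (auto simp: in_flight_def)

lemma in_flightE:
  assumes "b \<in> in_flight n X X' p"
  obtains i j where "i \<le> p" "X i = b" "p < j" "X' j = b" "b \<le> n"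
  using assms by (auto simp: in_flight_def)

text \<open>Schensted's bumping rule for a carrier holding \<open>D\<close> that arrives at a box with content \<open>v\<close>.\<close>

definition dropped :: "nat \<Rightarrow> nat set \<Rightarrow> nat \<Rightarrow> nat" where
  "dropped n D v =
     (if {c \<in> D. v = n + 1 \<or> v < c} = {} then n + 1 else Min {c \<in> D. v = n + 1 \<or> v < c})"

text \<open>The bumping rule determines \<open>X'\<close> from \<open>X\<close>, and it makes sense for every set of labels. It
  therefore replaces \<open>BB n\<close> from now on, whose definition needs all of \<open>1, \<dots>, n\<close> to be present.\<close>

locale sweep =
  fixes n :: nat and B :: "nat set" and X X' :: config
  assumes before: "arrangement n B X" and after: "arrangement n B X'"
    and rule: "\<And>p. X' p = dropped n (in_flight n X X' (p - 1)) (X p)"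

lemma jump_outcome:
  assumes "arrangement n B Z" "b \<in> B" "Z i = b"
  obtains j where "i < j" "Z j = n + 1" "\<And>p. i < p \<Longrightarrow> p < j \<Longrightarrow> Z p \<noteq> n + 1"
    "jump n b Z = Z(i := n + 1, j := b)"
proof -
  have fin: "finite {k. Z k \<le> n}" by (rule arrangement_finite[OF assms(1)])
  have "\<exists>k. Z (i + 1 + int k) = n + 1"
  proof (rule ccontr)
    assume no: "\<nexists>k. Z (i + 1 + int k) = n + 1"
    have "Z (i + 1 + int k) \<le> n" for k
      using no arrangement_le[OF assms(1), of "i + 1 + int k"] by (auto simp: le_Suc_eq)
    hence "range (\<lambda>k. i + 1 + int k) \<subseteq> {k. Z k \<le> n}" by auto
    hence "finite (range (\<lambda>k::nat. i + 1 + int k))" using fin finite_subset by blast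
    moreover have "inj (\<lambda>k::nat. i + 1 + int k)" by (auto intro: injI)
    ultimately show False using finite_imageD infinite_UNIV_nat by blast
  qed
  then obtain k where k: "Z (i + 1 + int k) = n + 1" "\<And>m. m < k \<Longrightarrow> Z (i + 1 + int m) \<noteq> n + 1"
    using exists_least_iff[of "\<lambda>k. Z (i + 1 + int k) = n + 1"] by blast
  define j where "j = i + 1 + int k"
  have gap: "Z p \<noteq> n + 1" if "i < p" "p < j" for p
    using k(2)[of "nat (p - i - 1)"] that by (auto simp: j_def)
  have "(LEAST j. i < j \<and> Z j = n + 1) = j"
    using k(1) gap by (intro Least_equality) (auto simp: j_def intro: leI)
  moreover have "(THE i. Z i = b) = i"
    using assms arrangement_inj[OF assms(1), of _ i]
    by (intro the_equality) (auto simp: arrangement_def)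
  ultimately have "jump n b Z = Z(i := n + 1, j := b)" by (simp add: jump_def)
  with that[of j] k(1) gap show ?thesis by (auto simp: j_def)
qed

text \<open>The invariant of the loop over the balls. The last clause records why ball \<open>c\<close> did not stop earlier:
  a box that it passed held a larger ball, which had not moved yet, or had already been taken by a
  smaller one. The clause about box \<open>j\<close> says that its original ball, if any, had moved away.\<close>

definition after_jumps :: "nat \<Rightarrow> nat \<Rightarrow> config \<Rightarrow> config \<Rightarrow> bool" where
  "after_jumps n b X Z \<longleftrightarrow> arrangement n {1..n} Z \<and>
    (\<forall>i c. b < c \<longrightarrow> c \<le> n \<longrightarrow> (Z i = c \<longleftrightarrow> X i = c)) \<and>
    (\<forall>c. 1 \<le> c \<longrightarrow> c \<le> b \<longrightarrow> (\<exists>i j. X i = c \<and> Z j = c \<and> i < j \<and> (X j = n + 1 \<or> X j < c) \<and>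
       (\<forall>p. i < p \<and> p < j \<longrightarrow> (c < X p \<and> X p \<le> n) \<or> (\<exists>a. 1 \<le> a \<and> a < c \<and> Z p = a))))"

lemma after_jumps_fold:
  assumes "arrangement n {1..n} X" "b \<le> n"
  shows "after_jumps n b X (fold (jump n) [1..<b + 1] X)"
  using assms(2)
proof (induction b)
  case 0
  show ?case using assms(1) by (simp add: after_jumps_def)
next
  case (Suc b)
  define Z where "Z = fold (jump n) [1..<b + 1] X"
  have "after_jumps n b X Z" using Suc unfolding Z_def by simp
  note IH = this[unfolded after_jumps_def, THEN conjunct1]
    this[unfolded after_jumps_def, THEN conjunct2, THEN conjunct1, rule_format]
    this[unfolded after_jumps_def, THEN conjunct2, THEN conjunct2, rule_format]
  have b: "Suc b \<in> {1..n}" using Suc.prems by auto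
  obtain i where i: "Z i = Suc b" using IH(1) b unfolding arrangement_def by blast
  obtain j where j: "i < j" "Z j = n + 1" "\<And>p. i < p \<Longrightarrow> p < j \<Longrightarrow> Z p \<noteq> n + 1"
    "jump n (Suc b) Z = Z(i := n + 1, j := Suc b)"
    using jump_outcome[OF IH(1) b i] by metis
  have fold_eq: "fold (jump n) [1..<Suc b + 1] X = Z(i := n + 1, j := Suc b)"
    using j(4) by (simp add: Z_def)
  define Z' where "Z' = Z(i := n + 1, j := Suc b)"
  have arr: "arrangement n {1..n} Z'"
    unfolding Z'_def by (rule arrangement_relocate[OF IH(1) i b j(2)])
  have later: "Z' k = c \<longleftrightarrow> X k = c" if "Suc b < c" "c \<le> n" for k c
    using IH(2)[of c k] that i j(2) by (auto simp: Z'_def)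
  have keep: "Z' p = a" if "Z p = a" "a \<le> b" for p a
    using that i j(2) b by (auto simp: Z'_def)
  have Xi: "X i = Suc b" using IH(2)[of "Suc b" i] i b by auto
  have Xj: "X j = n + 1 \<or> X j < Suc b"
  proof -
    have "X j \<le> n \<Longrightarrow> Suc b < X j \<Longrightarrow> False" using IH(2)[of "X j" j] j(2) by auto
    moreover have "X j \<noteq> Suc b" using Xi j(1) arrangement_inj[OF assms(1), of i j] b by auto
    ultimately show ?thesis using arrangement_le[OF assms(1), of j] by presburger
  qed
  have between: "(Suc b < X p \<and> X p \<le> n) \<or> (\<exists>a. 1 \<le> a \<and> a < Suc b \<and> Z' p = a)"
    if p: "i < p" "p < j" for p
  proof -
    have "Z p \<le> n" using j(3)[OF p] arrangement_le[OF IH(1), of p] by auto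
    hence "Z p \<in> {1..n}" by (rule arrangement_ball[OF IH(1)])
    moreover have "Z p \<noteq> Suc b" using arrangement_inj[OF IH(1), of p i] i p b by auto
    ultimately show ?thesis
      using IH(2)[of "Z p" p] keep[OF refl, of p] by (cases "Z p \<le> b") auto
  qed
  have "\<exists>i j. X i = c \<and> Z' j = c \<and> i < j \<and> (X j = n + 1 \<or> X j < c) \<and>
       (\<forall>p. i < p \<and> p < j \<longrightarrow> (c < X p \<and> X p \<le> n) \<or> (\<exists>a. 1 \<le> a \<and> a < c \<and> Z' p = a))"
    if c: "1 \<le> c" "c \<le> Suc b" for c
  proof (cases "c = Suc b")
    case True
    have "Z' j = Suc b" by (simp add: Z'_def)
    moreover have "\<forall>p. i < p \<and> p < j \<longrightarrow>
        (Suc b < X p \<and> X p \<le> n) \<or> (\<exists>a. 1 \<le> a \<and> a < Suc b \<and> Z' p = a)"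
      using between by blast
    ultimately show ?thesis unfolding True using Xi Xj j(1) by (intro exI[of _ i] exI[of _ j] conjI)
  next
    case False
    hence cb: "c \<le> b" using c by auto
    from IH(3)[OF c(1) cb] obtain i' j' where
      ij: "X i' = c" "Z j' = c" "i' < j'" "X j' = n + 1 \<or> X j' < c"
      "\<forall>p. i' < p \<and> p < j' \<longrightarrow> (c < X p \<and> X p \<le> n) \<or> (\<exists>a. 1 \<le> a \<and> a < c \<and> Z p = a)"
      by blast
    have "\<forall>p. i' < p \<and> p < j' \<longrightarrow> (c < X p \<and> X p \<le> n) \<or> (\<exists>a. 1 \<le> a \<and> a < c \<and> Z' p = a)"
    proof (intro allI impI)
      fix p assume "i' < p \<and> p < j'"
      with ij(5) consider "c < X p \<and> X p \<le> n" | a where "1 \<le> a" "a < c" "Z p = a" by metis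
      thus "(c < X p \<and> X p \<le> n) \<or> (\<exists>a. 1 \<le> a \<and> a < c \<and> Z' p = a)"
        using keep[of p] cb by cases auto
    qed
    with ij(1,3,4) keep[OF ij(2) cb] show ?thesis by (intro exI[of _ i'] exI[of _ j'] conjI)
  qed
  with arr later show ?case unfolding fold_eq Z'_def[symmetric] after_jumps_def
    by (intro conjI allI impI) (assumption | simp only:)+
qed

text \<open>The first ball to jump onto or over box \<open>p\<close> after that box has become empty lands there. Ball
  \<open>X p\<close> leaves when its own turn comes, so this is the smallest ball in flight that is larger than
  \<open>X p\<close>.\<close>

lemma BB_sweep:
  assumes "arrangement n {1..n} X"
  shows "sweep n {1..n} X (BB n X)"
proof
  define X' where "X' = BB n X"
  have "after_jumps n n X X'"
    using after_jumps_fold[OF assms order_refl] by (simp add: X'_def BB_def)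
  note stages = this[unfolded after_jumps_def, THEN conjunct1]
    this[unfolded after_jumps_def, THEN conjunct2, THEN conjunct2, rule_format]
  show "arrangement n {1..n} X" by fact
  show "arrangement n {1..n} (BB n X)" using stages(1) by (simp add: X'_def)
  fix p
  define D where "D = {c \<in> in_flight n X X' (p - 1). X p = n + 1 \<or> X p < c}"
  \<comment> \<open>A ball of \<open>D\<close> lands in box \<open>p\<close> or passes it; it can only pass because a smaller ball has landed
    there.\<close>
  have path: "X' p \<le> n \<and> X' p \<le> c" if cD: "c \<in> D" for c
  proof -
    obtain i' j' where ij: "i' \<le> p - 1" "X i' = c" "p - 1 < j'" "X' j' = c" "c \<le> n"
      and Xp: "X p = n + 1 \<or> X p < c"
      using cD unfolding D_def by (auto elim: in_flightE)
    have "1 \<le> c" using ij(2,5) arrangement_ball[OF assms, of i'] by auto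
    from stages(2)[OF this ij(5)] obtain i j where *: "X i = c" "X' j = c"
      "\<And>p. i < p \<and> p < j \<Longrightarrow> (c < X p \<and> X p \<le> n) \<or> (\<exists>a. 1 \<le> a \<and> a < c \<and> X' p = a)" by blast
    have "i = i'" "j = j'" using *(1,2) ij arrangement_inj[OF assms] arrangement_inj[OF stages(1)] by metis+
    show ?thesis
    proof (cases "p = j'")
      case True
      thus ?thesis using ij by auto
    next
      case False
      hence "i < p \<and> p < j" using ij \<open>i = i'\<close> \<open>j = j'\<close> by auto
      from *(3)[OF this] Xp show ?thesis using ij(5) by auto
    qed
  qed
  have mem: "X' p \<in> D" if "X' p \<le> n"
  proof -
    have "1 \<le> X' p" using arrangement_ball[OF stages(1) that] by auto
    from stages(2)[OF this that] obtain i j where *: "X i = X' p" "X' j = X' p" "i < j"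
      "X j = n + 1 \<or> X j < X' p" by blast
    have "j = p" using arrangement_inj[OF stages(1)] * that by metis
    have "i \<le> p - 1" using *(3) \<open>j = p\<close> by auto
    hence "X' p \<in> in_flight n X X' (p - 1)" using * that \<open>j = p\<close> by (intro in_flightI[of X i _ _ X' p]) auto
    thus ?thesis using *(4) \<open>j = p\<close> by (simp add: D_def)
  qed
  show "BB n X p = dropped n (in_flight n X (BB n X) (p - 1)) (X p)"
  proof (cases "D = {}")
    case True
    hence "X' p = n + 1" using mem arrangement_le[OF stages(1), of p] by (auto simp: le_Suc_eq)
    with True show ?thesis unfolding dropped_def D_def X'_def by auto
  next
    case False
    have "finite D" by (rule finite_subset[of _ "{..n}"]) (auto simp: D_def in_flight_def)
    have "X' p \<in> D" using False path mem by blast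
    with \<open>finite D\<close> path have "Min D = X' p" by (intro Min_eqI) auto
    with False show ?thesis unfolding dropped_def D_def X'_def by auto
  qed
qed

context sweep
begin

abbreviation carrier :: "int \<Rightarrow> nat set" where
  "carrier p \<equiv> in_flight n X X' p"

lemma finite_carrier [simp]: "finite (carrier p)"
  by (rule finite_subset[of _ "{..n}"]) (auto simp: in_flight_def)

lemma carrier_le: "c \<in> carrier p \<Longrightarrow> c \<le> n"
  by (simp add: in_flight_def)

lemma carrier_subset: "carrier p \<subseteq> B"
  using arrangement_ball[OF before] by (auto simp: in_flight_def)

lemma le_empty: "X p \<le> Suc n" "X' p \<le> Suc n"
  using arrangement_le[OF before, of p] arrangement_le[OF after, of p] by auto

lemma drop_cases:
  obtains (nothing) "X' p = n + 1" "X p \<noteq> n + 1 \<or> carrier (p - 1) = {}"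
      "\<And>c. c \<in> carrier (p - 1) \<Longrightarrow> c \<le> X p"
  | (ball) "X' p \<in> carrier (p - 1)" "X' p \<le> n" "X p = n + 1 \<or> X p < X' p"
      "\<And>c. c \<in> carrier (p - 1) \<Longrightarrow> X p = n + 1 \<or> X p < c \<Longrightarrow> X' p \<le> c"
proof (cases "{c \<in> carrier (p - 1). X p = n + 1 \<or> X p < c} = {}")
  case True
  hence "X' p = n + 1" using rule[of p] by (simp add: dropped_def)
  moreover have "X p \<noteq> n + 1 \<or> carrier (p - 1) = {}" using True by blast
  moreover have "c \<le> X p" if "c \<in> carrier (p - 1)" for c using True that by (force simp: not_less)
  ultimately show ?thesis by (rule nothing)
next
  case False
  let ?D = "{c \<in> carrier (p - 1). X p = n + 1 \<or> X p < c}"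
  have "X' p = Min ?D" using False rule[of p] unfolding dropped_def by (metis (lifting))
  moreover have "finite ?D" by simp
  ultimately have "X' p \<in> ?D" "\<And>c. c \<in> ?D \<Longrightarrow> X' p \<le> c" using False Min_in[of ?D] by auto
  with ball carrier_le show ?thesis by blast
qed

lemma ball_ahead: "X q \<le> n \<Longrightarrow> p < q \<Longrightarrow> X q \<notin> carrier p"
  using arrangement_inj[OF before] by (fastforce simp: in_flight_def)

lemma ball_behind: "X' q \<le> n \<Longrightarrow> q \<le> p \<Longrightarrow> X' q \<notin> carrier p"
  using arrangement_inj[OF after] by (fastforce simp: in_flight_def)

text \<open>Every ball moves to the right: it is dropped from the carrier, hence was picked up in an earlier
  box.\<close>

lemma ball_loaded: assumes "X p \<le> n" shows "X p \<in> carrier p"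
proof -
  obtain j where j: "X' j = X p"
    using arrangement_ball[OF before assms] after by (auto simp: arrangement_def)
  have "X' j \<in> carrier (j - 1)" using j assms by (cases j rule: drop_cases) auto
  then obtain i where "i \<le> j - 1" "X i = X p" using j by (auto simp: in_flight_def)
  hence "p < j" using arrangement_inj[OF before, of i p] assms by auto
  with j assms show ?thesis by (auto simp: in_flight_def)
qed

lemma carrier_step: "carrier p = insert (X p) (carrier (p - 1)) - {X' p, n + 1}"
proof (intro equalityI subsetI)
  fix b assume b: "b \<in> carrier p"
  then obtain i j where ij: "i \<le> p" "X i = b" "p < j" "X' j = b" "b \<le> n"
    by (rule in_flightE)
  have "b \<noteq> X' p" using ij arrangement_inj[OF after, of j p] by auto
  moreover have "b = X p \<or> b \<in> carrier (p - 1)"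
  proof (cases "i = p")
    case False
    with ij have "b \<in> carrier (p - 1)" by (intro in_flightI[of X i _ _ X' j]) auto
    thus ?thesis ..
  qed (use ij in auto)
  ultimately show "b \<in> insert (X p) (carrier (p - 1)) - {X' p, n + 1}" using ij by auto
next
  fix b assume b: "b \<in> insert (X p) (carrier (p - 1)) - {X' p, n + 1}"
  show "b \<in> carrier p"
  proof (cases "b = X p")
    case True
    with b ball_loaded[of p] le_empty[of p] show ?thesis by (auto simp: le_Suc_eq)
  next
    case False
    with b have "b \<in> carrier (p - 1)" by blast
    then obtain i j where ij: "i \<le> p - 1" "X i = b" "p - 1 < j" "X' j = b" "b \<le> n"
      by (rule in_flightE)
    moreover have "j \<noteq> p" using b ij by auto
    ultimately show ?thesis by (intro in_flightI[of X i _ _ X' j]) auto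
  qed
qed

lemma dropped_le: "c \<in> carrier (p - 1) \<Longrightarrow> X p = n + 1 \<or> X p < c \<Longrightarrow> X' p \<le> c"
  by (cases p rule: drop_cases) (use not_less in blast)+

lemma dropped_ball:
  assumes "X' p \<le> n" shows "X' p \<in> carrier (p - 1)" "X p = n + 1 \<or> X p < X' p"
  using assms by (cases p rule: drop_cases; auto)+

lemma dropped_greater: "X p \<le> n \<Longrightarrow> X p < X' p"
  by (cases p rule: drop_cases) auto

subsection \<open>Descents are conserved\<close>

text \<open>If box \<open>i\<close> holds a ball, that ball is in the carrier at box \<open>i + 1\<close>, and it is smaller than what
  was dropped at \<open>i\<close>; so a smaller or empty box \<open>i + 1\<close> produces a descent. Otherwise whatever
  is dropped at \<open>i + 1\<close> was already available at \<open>i\<close>, where the smallest such ball was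
  taken.\<close>

lemma descent_iff: "X' (i + 1) < X' i \<longleftrightarrow> X i \<le> n \<and> (X (i + 1) = n + 1 \<or> X (i + 1) < X i)"
proof
  assume "X i \<le> n \<and> (X (i + 1) = n + 1 \<or> X (i + 1) < X i)"
  hence "X' (i + 1) \<le> X i" "X i < X' i"
    using dropped_le[of "X i" "i + 1"] ball_loaded[of i] dropped_greater[of i] by auto
  thus "X' (i + 1) < X' i" by simp
next
  assume desc: "X' (i + 1) < X' i"
  hence ball: "X' (i + 1) \<le> n" using le_empty(2)[of i] by auto
  have u: "X' (i + 1) \<in> carrier i" "X (i + 1) = n + 1 \<or> X (i + 1) < X' (i + 1)"
    using dropped_ball[OF ball] by auto
  show "X i \<le> n \<and> (X (i + 1) = n + 1 \<or> X (i + 1) < X i)"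
  proof (rule ccontr)
    assume neg: "\<not> ?thesis"
    have i: "X i = n + 1 \<or> X i < X' (i + 1) \<and> X i \<noteq> X' (i + 1)"
      using neg u(2) le_empty(1)[of i] by (auto simp: le_Suc_eq)
    have "X' (i + 1) \<in> insert (X i) (carrier (i - 1))" using u(1) unfolding carrier_step[of i] by blast
    moreover have "X' (i + 1) \<noteq> X i" using i ball by linarith
    ultimately have "X' (i + 1) \<in> carrier (i - 1)" by blast
    with i have "X' i \<le> X' (i + 1)" by (intro dropped_le) auto
    with desc show False by simp
  qed
qed

text \<open>By \<open>descent_iff\<close> the move keeps the descents between two balls, destroys those at the left end of a
  maximal group of adjacent balls, and creates one at the right end of each such group. There are as
  many left ends as right ends.\<close>

lemma card_descents: "card (descents X') = card (descents X)"
proof -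
  define P where "P = {i. X i \<le> n}"
  define Q where "Q = {i. X (i + 1) \<le> n}"
  define R where "R = {i. X (i + 1) < X i \<and> X i \<le> n}"
  have fin: "finite P" "finite Q" "card P = card Q"
    unfolding P_def Q_def using arrangement_finite[OF before] card_ball_shift[OF before] by auto
  have "finite R" by (rule finite_subset[OF _ fin(1)]) (auto simp: R_def P_def)
  have "descents X' = R \<union> (P - Q)"
    using descent_iff le_empty(1) by (auto simp: descents_def P_def Q_def R_def le_Suc_eq)
  moreover have "R \<inter> (P - Q) = {}" by (auto simp: R_def P_def Q_def)
  moreover have "descents X = R \<union> (Q - P)"
  proof (intro set_eqI)
    fix i show "i \<in> descents X \<longleftrightarrow> i \<in> R \<union> (Q - P)"
      using le_empty(1)[of i] le_empty(1)[of "i + 1"]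
      by (auto simp: descents_def P_def Q_def R_def le_Suc_eq)
  qed
  moreover have "R \<inter> (Q - P) = {}" by (auto simp: R_def P_def Q_def)
  moreover have "card (P - Q) = card (Q - P)"
    using fin by (simp add: card_Diff_subset_Int Int_commute)
  ultimately show ?thesis using fin \<open>finite R\<close> by (simp add: card_Un_disjoint)
qed

lemma card_links_eq: "card (links n X') = card (links n X)"
  using card_links(2)[OF before] card_links(2)[OF after] card_descents by simp

subsection \<open>The load of the carrier\<close>

text \<open>A ball \<open>v\<close> that is picked up pushes out a ball larger than \<open>v\<close>, so the number of balls of size at
  most \<open>x\<close> never decreases.\<close>

lemma small_load_mono:
  assumes "X p \<le> n"
  shows "card {c \<in> carrier (p - 1). c \<le> x} \<le> card {c \<in> carrier p. c \<le> x}"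
proof (cases "X' p \<in> carrier (p - 1) \<and> X' p \<le> x")
  case True
  have "X p < X' p" using dropped_greater[OF assms] .
  have "X p \<notin> carrier (p - 1)" using ball_ahead[OF assms] by simp
  moreover have "X' p \<le> n" using True carrier_le by blast
  ultimately have "{c \<in> carrier p. c \<le> x} = insert (X p) ({c \<in> carrier (p - 1). c \<le> x} - {X' p})"
    using True assms \<open>X p < X' p\<close> by (auto simp: carrier_step[of p] dest: carrier_le)
  thus ?thesis using \<open>X p \<notin> carrier (p - 1)\<close> True
    by (simp add: card_Diff_singleton_if)
next
  case False
  have "{c \<in> carrier (p - 1). c \<le> x} \<subseteq> {c \<in> carrier p. c \<le> x}"
    using False carrier_le by (fastforce simp: carrier_step[of p])
  thus ?thesis by (intro card_mono) auto
qed

text \<open>Schensted's lower bound for the first row. The threshold \<open>x\<close> makes the induction work: when the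
  next element \<open>v\<close> of the subsequence arrives, the balls below \<open>v\<close> counted so far stay and \<open>v\<close> joins
  them. Boxes must be full since an empty box would take a ball away.\<close>

lemma increasing_subsequence_load:
  assumes "\<And>i. p < i \<Longrightarrow> i \<le> p + int k \<Longrightarrow> X i \<le> n" "strict_mono_on S X"
    "\<And>s. s \<in> S \<Longrightarrow> p < s \<Longrightarrow> s \<le> p + int k \<Longrightarrow> X s \<le> x"
  shows "card (S \<inter> {p<..p + int k}) \<le> card {c \<in> carrier (p + int k). c \<le> x}"
  using assms(1,3)
proof (induction k arbitrary: x)
  case 0
  thus ?case by simp
next
  case (Suc k)
  define q where "q = p + int k"
  have q: "p + int (Suc k) = q + 1" by (simp add: q_def)
  have Xq: "X (q + 1) \<le> n" using Suc.prems(1)[of "q + 1"] by (simp add: q_def)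
  show ?case
  proof (cases "q + 1 \<in> S")
    case False
    hence "s \<in> S \<Longrightarrow> s \<le> q + 1 \<Longrightarrow> s \<le> q" for s by (cases "s = q + 1") auto
    hence "S \<inter> {p<..p + int (Suc k)} = S \<inter> {p<..p + int k}"
      unfolding q by (auto simp: q_def)
    also have "card \<dots> \<le> card {c \<in> carrier (p + int k). c \<le> x}"
      using Suc.prems by (intro Suc.IH) auto
    also have "\<dots> \<le> card {c \<in> carrier (q + 1). c \<le> x}"
      using small_load_mono[OF Xq, of x] by (simp add: q_def)
    finally show ?thesis unfolding q .
  next
    case True
    let ?v = "X (q + 1)"
    have v: "1 \<le> ?v" using arrangement_ball[OF before Xq] arrangement_labels[OF before] by auto
    have "?v \<le> x" using Suc.prems(2)[OF True] by (simp add: q_def)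
    have lt: "X s < ?v" if "s \<in> S" "s \<le> q" for s
      using strict_mono_onD[OF assms(2) that(1) True] that(2) by simp
    have "card (S \<inter> {p<..p + int k}) \<le> card {c \<in> carrier (p + int k). c \<le> ?v - 1}"
    proof (rule Suc.IH)
      fix s assume "s \<in> S" "p < s" "s \<le> p + int k"
      thus "X s \<le> ?v - 1" using lt[of s] by (simp add: q_def)
    qed (use Suc.prems in auto)
    moreover have "S \<inter> {p<..p + int (Suc k)} = insert (q + 1) (S \<inter> {p<..p + int k})"
      using True unfolding q by (auto simp: q_def)
    moreover have "q + 1 \<notin> S \<inter> {p<..p + int k}" by (simp add: q_def)
    ultimately have "card (S \<inter> {p<..p + int (Suc k)}) \<le> Suc (card {c \<in> carrier q. c \<le> ?v - 1})"
      by (simp add: q_def)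
    also have "\<dots> = card (insert ?v {c \<in> carrier q. c \<le> ?v - 1})"
      using v by (subst card_insert_disjoint) auto
    also have "\<dots> \<le> card {c \<in> carrier (q + 1). c \<le> x}"
    proof (rule card_mono)
      show "insert ?v {c \<in> carrier q. c \<le> ?v - 1} \<subseteq> {c \<in> carrier (q + 1). c \<le> x}"
        using dropped_greater[OF Xq] Xq \<open>?v \<le> x\<close> v by (auto simp: carrier_step[of "q + 1"])
    qed simp
    finally show ?thesis unfolding q .
  qed
qed

text \<open>A ball of the block that has been picked up is smaller than all later balls of the block, hence is never
  pushed out by them.\<close>

lemma block_loaded:
  assumes "sorted_wrt (<) xs" "\<And>j. j < length xs \<Longrightarrow> X (a + 1 + int j) = xs ! j \<and> xs ! j \<le> n"
  shows "j \<le> length xs \<Longrightarrow> set (take j xs) \<subseteq> carrier (a + int j)"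
proof (induction j)
  case (Suc j)
  let ?p = "a + 1 + int j"
  have Xp: "X ?p = xs ! j" "X ?p \<le> n" using assms(2)[of j] Suc.prems by auto
  have "c < xs ! j" if c: "c \<in> set (take j xs)" for c
  proof -
    obtain i where "i < j" "c = xs ! i" using c Suc.prems by (auto simp: in_set_conv_nth)
    thus ?thesis using sorted_wrt_nth_less[OF assms(1), of i j] Suc.prems by simp
  qed
  hence lt: "c \<noteq> X' ?p \<and> c \<le> n" if "c \<in> set (take (Suc j) xs)" for c
    using that dropped_greater[OF Xp(2)] Xp Suc.prems by (force simp: take_Suc_conv_app_nth)
  have "set (take (Suc j) xs) \<subseteq> insert (X ?p) (carrier (?p - 1))"
    using Suc Xp by (auto simp: take_Suc_conv_app_nth)
  with lt have "set (take (Suc j) xs) \<subseteq> carrier ?p" by (fastforce simp: carrier_step[of ?p])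
  thus ?case by (simp add: algebra_simps)
qed simp

subsection \<open>Unloading beyond the last ball\<close>

lemma unload:
  assumes empty: "\<And>i. q < i \<Longrightarrow> X i = n + 1"
  defines "xs \<equiv> sorted_list_of_set (carrier q)"
  shows "carrier (q + int j) = set (drop j xs)"
    and "X' (q + 1 + int j) = (if j < length xs then xs ! j else n + 1)"
proof -
  have xs: "sorted xs" "distinct xs" "set xs = carrier q" by (auto simp: xs_def)
  have step: "X' (q + 1 + int j) = (if j < length xs then xs ! j else n + 1)"
    if c: "carrier (q + int j) = set (drop j xs)" for j
  proof -
    let ?p = "q + 1 + int j"
    have e: "X ?p = n + 1" using empty by simp
    have C: "carrier (?p - 1) = set (drop j xs)" using c by (simp add: algebra_simps)
    show ?thesis
    proof (cases "j < length xs")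
      case True
      hence d: "drop j xs = xs ! j # drop (Suc j) xs" by (simp add: Cons_nth_drop_Suc)
      have "Min (set (drop j xs)) = xs ! j"
        using sorted_wrt_drop[OF xs(1), of j] d by (intro Min_eqI) auto
      moreover have "{c \<in> carrier (?p - 1). X ?p = n + 1 \<or> X ?p < c} = set (drop j xs)"
        using C e by simp
      moreover have "set (drop j xs) \<noteq> {}" using d by simp
      ultimately show ?thesis using rule[of ?p] True unfolding dropped_def by simp
    next
      case False
      thus ?thesis using rule[of ?p] C e by (simp add: dropped_def)
    qed
  qed
  have carr: "carrier (q + int j) = set (drop j xs)" for j
  proof (induction j)
    case 0
    thus ?case using xs by simp
  next
    case (Suc j)
    let ?p = "q + 1 + int j"
    have "carrier ?p = set (drop j xs) - {X' ?p, n + 1}"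
      using carrier_step[of ?p] empty[of ?p] Suc by (auto simp: algebra_simps)
    also have "\<dots> = set (drop (Suc j) xs)"
    proof (cases "j < length xs")
      case True
      hence d: "drop j xs = xs ! j # drop (Suc j) xs" by (simp add: Cons_nth_drop_Suc)
      have "distinct (drop j xs)" using xs by simp
      moreover have "n + 1 \<notin> set (drop j xs)" using xs(3) carrier_le set_drop_subset[of j xs] by fastforce
      ultimately show ?thesis using d step[OF Suc] True by auto
    qed simp
    finally show ?case by (simp add: algebra_simps)
  qed
  show "carrier (q + int j) = set (drop j xs)" by (rule carr)
  show "X' (q + 1 + int j) = (if j < length xs then xs ! j else n + 1)" by (rule step[OF carr])
qed

end

section \<open>The rightmost run\<close>

definition front :: "nat \<Rightarrow> config \<Rightarrow> int" where
  "front n X = Max {i. X i \<le> n}"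

lemma front_ball:
  assumes "arrangement n B X" "B \<noteq> {}"
  shows "X (front n X) \<le> n"
proof -
  have "{i. X i \<le> n} \<noteq> {}"
    using arrangement_bij[OF assms(1)] assms(2) by (auto simp: bij_betw_def)
  thus ?thesis
    using Max_in[OF arrangement_finite[OF assms(1)]] unfolding front_def by simp
qed

lemma beyond_front:
  assumes "arrangement n B X" "front n X < i"
  shows "X i = n + 1"
proof -
  have "\<not> X i \<le> n"
    using assms(2) Max_ge[OF arrangement_finite[OF assms(1)], of i] unfolding front_def by auto
  thus ?thesis using arrangement_le[OF assms(1), of i] by simp
qed

text \<open>The rightmost run of \<open>X\<close> is \<open>xs\<close>, and it starts in box \<open>a + 1\<close>. The descent from box \<open>a\<close> separates it
  from what stands to its left.\<close>

definition ends_with :: "nat \<Rightarrow> config \<Rightarrow> int \<Rightarrow> nat list \<Rightarrow> bool" where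
  "ends_with n X a xs \<longleftrightarrow> sorted_wrt (<) xs \<and> set xs \<subseteq> {..n} \<and> X (a + 1) < X a \<and>
     (\<forall>j<length xs. X (a + 1 + int j) = xs ! j) \<and> (\<forall>i>a + int (length xs). X i = n + 1)"

text \<open>The balls unloaded beyond the last ball, which form the rightmost run after the move.\<close>

definition final_load :: "nat \<Rightarrow> config \<Rightarrow> config \<Rightarrow> nat set" where
  "final_load n X X' = in_flight n X X' (front n X)"

context sweep
begin

lemma final_load_finite [simp]: "finite (final_load n X X')"
  by (simp add: final_load_def)

lemma final_load_subset: "final_load n X X' \<subseteq> B"
  using carrier_subset by (simp add: final_load_def)

lemma front_in_final_load: "B \<noteq> {} \<Longrightarrow> X (front n X) \<in> final_load n X X'"
  unfolding final_load_def by (intro ball_loaded front_ball[OF before])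

lemma after_ends_with:
  assumes "B \<noteq> {}"
  shows "ends_with n X' (front n X) (sorted_list_of_set (final_load n X X'))"
proof -
  let ?q = "front n X" and ?xs = "sorted_list_of_set (final_load n X X')"
  have X': "X' (?q + 1 + int j) = (if j < length ?xs then ?xs ! j else n + 1)" for j
    unfolding final_load_def by (rule unload(2)) (rule beyond_front[OF before])
  have "X' (?q + 1) < X' ?q"
    using front_ball[OF before assms] beyond_front[OF before, of "?q + 1"] by (simp add: descent_iff)
  moreover have "X' i = n + 1" if "i > ?q + int (length ?xs)" for i
    using X'[of "nat (i - ?q - 1)"] that by (auto split: if_splits)
  moreover have "set ?xs \<subseteq> {..n}" using carrier_le by (auto simp: final_load_def)
  ultimately show ?thesis using X' by (simp add: ends_with_def)
qed

lemma front_after: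
  assumes "B \<noteq> {}"
  shows "front n X' = front n X + int (card (final_load n X X'))"
  unfolding front_def[of n X']
proof (rule Max_eqI)
  let ?E = "final_load n X X'" and ?xs = "sorted_list_of_set (final_load n X X')"
  note ew = after_ends_with[OF assms, unfolded ends_with_def]
  have "?E \<noteq> {}" using front_in_final_load[OF assms] by auto
  hence pos: "0 < card ?E" by (simp add: card_gt_0_iff)
  let ?j = "card ?E - 1"
  have "\<And>j. j < length ?xs \<Longrightarrow> X' (front n X + 1 + int j) = ?xs ! j" using ew by blast
  from this[of ?j] have "X' (front n X + 1 + int ?j) = ?xs ! ?j" using pos by simp
  moreover have "?xs ! ?j \<in> set ?xs" using pos by (intro nth_mem) simp
  ultimately have "X' (front n X + 1 + int ?j) \<le> n" using ew by auto
  thus "front n X + int (card ?E) \<in> {i. X' i \<le> n}" using pos by simp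
  show "i \<le> front n X + int (card ?E)" if "i \<in> {i. X' i \<le> n}" for i
  proof (rule ccontr)
    assume "\<not> ?thesis"
    hence "X' i = n + 1" using ew by simp
    with that show False by simp
  qed
qed (rule arrangement_finite[OF after])

end

text \<open>The first load is the rightmost run during the second move, so it is picked up completely.\<close>

lemma final_load_mono:
  assumes "sweep n B X X'" "sweep n B X' X''" "B \<noteq> {}"
  shows "final_load n X X' \<subseteq> final_load n X' X''"
proof -
  interpret S: sweep n B X X' by fact
  interpret S': sweep n B X' X'' by fact
  let ?xs = "sorted_list_of_set (final_load n X X')"
  have ew: "sorted_wrt (<) ?xs" "set ?xs \<subseteq> {..n}" "\<And>j. j < length ?xs \<Longrightarrow> X' (front n X + 1 + int j) = ?xs ! j"
    using S.after_ends_with[OF assms(3)] by (auto simp: ends_with_def)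
  have "X' (front n X + 1 + int j) = ?xs ! j \<and> ?xs ! j \<le> n" if "j < length ?xs" for j
    using ew(3)[OF that] ew(2) nth_mem[OF that] by auto
  from S'.block_loaded[OF ew(1) this order_refl] show ?thesis
    using S.front_after[OF assms(3)] by (simp add: final_load_def)
qed

section \<open>Peeling off the rightmost run\<close>

definition remove_balls :: "nat \<Rightarrow> nat set \<Rightarrow> config \<Rightarrow> config" where
  "remove_balls n S X = (\<lambda>i. if X i \<in> S then n + 1 else X i)"

lemma arrangement_remove:
  assumes "arrangement n B X" "S \<subseteq> B"
  shows "arrangement n (B - S) (remove_balls n S X)"
  unfolding arrangement_def
proof (intro conjI ballI)
  show "B - S \<subseteq> {1..n}" using arrangement_labels[OF assms(1)] by auto
  show "range (remove_balls n S X) \<subseteq> insert (n + 1) (B - S)"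
  proof (rule image_subsetI)
    fix i show "remove_balls n S X i \<in> insert (n + 1) (B - S)"
      using arrangement_cases[OF assms(1), of i] by (simp add: remove_balls_def)
  qed
  fix b assume b: "b \<in> B - S"
  hence "b \<noteq> n + 1" using arrangement_labels[OF assms(1)] by auto
  hence "remove_balls n S X i = b \<longleftrightarrow> X i = b" for i using b by (auto simp: remove_balls_def)
  moreover have "\<exists>!i. X i = b" using assms(1) b by (simp add: arrangement_def)
  ultimately show "\<exists>!i. remove_balls n S X i = b" by simp
qed

lemma in_flight_remove:
  "in_flight n (remove_balls n S X) (remove_balls n S X') p = in_flight n X X' p - S"
proof -
  have "remove_balls n S Z i = b \<longleftrightarrow> Z i = b \<and> b \<notin> S" if "b \<le> n" for Z i b
    using that by (auto simp: remove_balls_def)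
  thus ?thesis by (auto simp: in_flight_def)
qed

lemma ends_with_position:
  assumes "arrangement n B X" "ends_with n X a xs" "X i \<in> set xs"
  obtains j where "j < length xs" "i = a + 1 + int j" "X i = xs ! j"
proof -
  obtain j where j: "j < length xs" "X i = xs ! j" using assms(3) by (auto simp: in_set_conv_nth)
  hence "X i = X (a + 1 + int j)" using assms(2) by (simp add: ends_with_def)
  moreover have "X i \<le> n" using assms(2,3) by (auto simp: ends_with_def)
  ultimately have "i = a + 1 + int j" by (rule arrangement_inj[OF assms(1)])
  with j that show ?thesis by blast
qed

text \<open>No link joins the rightmost run to the rest, and its own links depend only on its content.\<close>

lemma links_remove:
  assumes arr: "arrangement n B X" and ew: "ends_with n X a xs"
  shows "links n X = links n (remove_balls n (set xs) X) \<union> {(xs ! j, xs ! Suc j) | j. Suc j < length xs}"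
    (is "_ = ?Y \<union> ?S")
proof (intro equalityI subsetI)
  note E = ew[unfolded ends_with_def]
  fix z assume "z \<in> links n X"
  then obtain i where i: "z = (X i, X (i + 1))" "X i < X (i + 1)" "X (i + 1) \<le> n"
    by (auto simp: links_def)
  have "i \<noteq> a" using E i(2) by auto
  then consider "i < a" | "i > a" by linarith
  thus "z \<in> ?Y \<union> ?S"
  proof cases
    case 1
    have "X k \<notin> set xs" if "k \<le> a" for k
      using ends_with_position[OF arr ew, of k] that by force
    hence "remove_balls n (set xs) X i = X i" "remove_balls n (set xs) X (i + 1) = X (i + 1)"
      using 1 by (simp_all add: remove_balls_def)
    hence "z \<in> ?Y" using i by (auto simp: links_def)
    thus ?thesis ..
  next
    case 2
    define j where "j = nat (i - a - 1)"
    have ij: "i = a + 1 + int j" using 2 by (simp add: j_def)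
    have "\<not> i + 1 > a + int (length xs)"
    proof
      assume "i + 1 > a + int (length xs)"
      hence "X (i + 1) = n + 1" using E by blast
      with i(3) show False by simp
    qed
    hence j: "Suc j < length xs" using ij by simp
    have "X i = xs ! j" using E j ij by simp
    moreover have "a + 1 + int (Suc j) = i + 1" using ij by simp
    hence "X (i + 1) = xs ! Suc j" using E j by metis
    ultimately have "z \<in> ?S" using i(1) j by auto
    thus ?thesis ..
  qed
next
  note E = ew[unfolded ends_with_def]
  fix z assume "z \<in> ?Y \<union> ?S"
  thus "z \<in> links n X"
  proof
    assume "z \<in> ?Y"
    then obtain i where i: "z = (remove_balls n (set xs) X i, remove_balls n (set xs) X (i + 1))"
      "remove_balls n (set xs) X i < remove_balls n (set xs) X (i + 1)"
      "remove_balls n (set xs) X (i + 1) \<le> n"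
      by (auto simp: links_def)
    hence "remove_balls n (set xs) X i = X i" "remove_balls n (set xs) X (i + 1) = X (i + 1)"
      by (auto simp: remove_balls_def split: if_splits)
    with i show ?thesis by (auto simp: links_def)
  next
    assume "z \<in> ?S"
    then obtain j where j: "z = (xs ! j, xs ! Suc j)" "Suc j < length xs" by blast
    have "xs ! j < xs ! Suc j" using E j(2) sorted_wrt_nth_less[of "(<)" xs j "Suc j"] by simp
    moreover have "xs ! Suc j \<le> n" using E nth_mem[OF j(2)] by auto
    moreover have "X (a + 1 + int j) = xs ! j" "X (a + 1 + int j + 1) = xs ! Suc j"
    proof -
      have all: "\<And>j. j < length xs \<Longrightarrow> X (a + 1 + int j) = xs ! j" using E by blast
      show "X (a + 1 + int j) = xs ! j" using all[of j] j(2) by simp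
      show "X (a + 1 + int j + 1) = xs ! Suc j" using all[of "Suc j"] j(2) by (simp add: algebra_simps)
    qed
    ultimately show ?thesis unfolding j(1) links_def by blast
  qed
qed

text \<open>The carrier leaves the run with exactly the balls of the run. A foreign ball smaller than a ball of
  the run that is still to come could never be pushed out by the rest of the run, so all foreign
  balls in the carrier are larger than the current ball of the run; those of the run that have been
  picked up are smaller. Hence the ball dropped is the smallest foreign ball, as if the box were
  empty.\<close>

lemma (in sweep) sweep_remove:
  assumes ew: "ends_with n X a xs" and load: "carrier (a + int (length xs)) = set xs"
  shows "sweep n (B - set xs) (remove_balls n (set xs) X) (remove_balls n (set xs) X')"
proof
  let ?S = "set xs" and ?b = "a + int (length xs)"
  have S: "?S \<subseteq> B" using carrier_subset load by blast
  show "arrangement n (B - ?S) (remove_balls n ?S X)" by (rule arrangement_remove[OF before S])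
  show "arrangement n (B - ?S) (remove_balls n ?S X')" by (rule arrangement_remove[OF after S])
  note E = ew[unfolded ends_with_def]
  have Sn: "c \<in> ?S \<Longrightarrow> c \<le> n" for c using E by auto
  have X_outside: "X p \<notin> ?S" if "p \<le> a" for p
    using ends_with_position[OF before ew, of p] that by force
  have X'_outside: "X' p \<notin> ?S" if "p \<le> ?b" for p
    using ball_behind[of p ?b] that load Sn by auto
  fix p
  have "remove_balls n ?S X' p = dropped n (carrier (p - 1) - ?S) (remove_balls n ?S X p)"
  proof -
    consider "p \<le> a" | "a < p" "p \<le> ?b" | "?b < p" by linarith
    thus ?thesis
    proof cases
      case 1
      have "c \<notin> carrier (p - 1)" if "c \<in> ?S" for c
      proof -
        obtain j where j: "j < length xs" "c = xs ! j" using \<open>c \<in> ?S\<close> by (auto simp: in_set_conv_nth)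
        hence "c = X (a + 1 + int j)" using E by simp
        thus ?thesis using ball_ahead[of "a + 1 + int j" "p - 1"] Sn[OF that] 1 by simp
      qed
      hence "carrier (p - 1) - ?S = carrier (p - 1)" by blast
      moreover have "remove_balls n ?S X p = X p" "remove_balls n ?S X' p = X' p"
        using X_outside[of p] X'_outside[of p] 1 by (simp_all add: remove_balls_def)
      ultimately show ?thesis using rule[of p] by simp
    next
      case 2
      define j where "j = nat (p - a - 1)"
      have j: "p = a + 1 + int j" "j < length xs" using 2 by (auto simp: j_def)
      have Xp: "X p = xs ! j" using E j by simp
      hence XpS: "X p \<in> ?S" using j(2) by simp
      have "{c \<in> carrier (p - 1). X p = n + 1 \<or> X p < c} = carrier (p - 1) - ?S"
      proof (intro equalityI subsetI)
        fix c assume "c \<in> {c \<in> carrier (p - 1). X p = n + 1 \<or> X p < c}"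
        hence c: "c \<in> carrier (p - 1)" "xs ! j < c" using Xp Sn[OF XpS] by auto
        have "c \<notin> ?S"
        proof
          assume "c \<in> ?S"
          then obtain i where i: "i < length xs" "c = xs ! i" by (auto simp: in_set_conv_nth)
          hence Xc: "c = X (a + 1 + int i)" using E by simp
          have "j < i"
          proof (rule ccontr)
            assume "\<not> j < i"
            hence "i = j \<or> i < j" by auto
            thus False using c(2) i(2) sorted_wrt_nth_less[of "(<)" xs i j] E j(2) by auto
          qed
          thus False using ball_ahead[of "a + 1 + int i" "p - 1"] Xc c(1) Sn[OF \<open>c \<in> ?S\<close>] j(1) by simp
        qed
        with c show "c \<in> carrier (p - 1) - ?S" by blast
      next
        fix c assume c: "c \<in> carrier (p - 1) - ?S"
        have "X p < c"
        proof (rule ccontr)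
          assume "\<not> X p < c"
          moreover have "X p \<noteq> c" using c XpS by blast
          ultimately have less: "c < xs ! j" using Xp by simp
          \<comment> \<open>The balls of the run still to come are larger than \<open>c\<close> and push out even larger ones, so \<open>c\<close>
            would stay in the carrier until the end of the run.\<close>
          have "j + k \<le> length xs \<Longrightarrow> c \<in> carrier (p - 1 + int k)" for k
          proof (induction k)
            case 0
            thus ?case using c by simp
          next
            case (Suc k)
            let ?r = "p + int k"
            have "\<And>j. j < length xs \<Longrightarrow> X (a + 1 + int j) = xs ! j" using E by blast
            from this[of "j + k"] have Xr: "X ?r = xs ! (j + k)"
              using Suc.prems j(1) by (simp add: algebra_simps)
            have "xs ! j \<le> xs ! (j + k)"
              using sorted_wrt_nth_less[of "(<)" xs j "j + k"] E Suc.prems by (cases k) auto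
            moreover have "xs ! (j + k) \<in> ?S" using Suc.prems by simp
            ultimately have "c < X' ?r" "c \<le> n"
              using dropped_greater[of ?r] Xr Sn[of "xs ! (j + k)"] less by auto
            moreover have "c \<in> carrier (?r - 1)" using Suc by (simp add: algebra_simps)
            ultimately have "c \<in> carrier ?r" unfolding carrier_step[of ?r] by simp
            thus ?case by (simp add: algebra_simps)
          qed
          from this[of "length xs - j"] have "c \<in> carrier ?b" using j by simp
          thus False using load c by blast
        qed
        thus "c \<in> {c \<in> carrier (p - 1). X p = n + 1 \<or> X p < c}" using c by blast
      qed
      moreover have "remove_balls n ?S X p = n + 1" "remove_balls n ?S X' p = X' p"
        using XpS X'_outside[of p] 2 by (simp_all add: remove_balls_def)
      moreover have "dropped n (carrier (p - 1)) (X p) = dropped n (carrier (p - 1) - ?S) (n + 1)"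
        unfolding dropped_def \<open>{c \<in> carrier (p - 1). X p = n + 1 \<or> X p < c} = _\<close>
        by (simp only: simp_thms Collect_mem_eq)
      ultimately show ?thesis using rule[of p] by simp
    next
      case 3
      have sub: "carrier (?b + int k) \<subseteq> ?S" for k
      proof (induction k)
        case 0
        thus ?case using load by simp
      next
        case (Suc k)
        let ?r = "?b + int k + 1"
        have "X ?r = n + 1" using E by simp
        hence "carrier ?r \<subseteq> carrier (?b + int k)" using carrier_step[of ?r] by auto
        with Suc show ?case by (simp add: algebra_simps)
      qed
      have C: "carrier (p - 1) - ?S = {}" using sub[of "nat (p - 1 - ?b)"] 3 by simp
      hence "X' p = n + 1 \<or> X' p \<in> ?S" by (cases p rule: drop_cases) auto
      hence "remove_balls n ?S X' p = n + 1" by (auto simp: remove_balls_def)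
      thus ?thesis unfolding C by (simp add: dropped_def)
    qed
  qed
  thus "remove_balls n ?S X' p = dropped n
      (in_flight n (remove_balls n ?S X) (remove_balls n ?S X') (p - 1)) (remove_balls n ?S X p)"
    by (simp add: in_flight_remove)
qed

section \<open>Links become stationary\<close>

lemma subset_chain_stabilizes:
  fixes E :: "nat \<Rightarrow> 'a set"
  assumes "\<And>t. E t \<subseteq> E (Suc t)" "\<And>t. E t \<subseteq> B" "finite B"
  obtains T where "\<And>t. T \<le> t \<Longrightarrow> E t = E T"
proof -
  have "finite (range (\<lambda>t. card (E t)))"
    by (rule finite_subset[of _ "{..card B}"]) (use card_mono[OF assms(3,2)] in blast, simp)
  note fin = this
  have "Max (range (\<lambda>t. card (E t))) \<in> range (\<lambda>t. card (E t))" by (rule Max_in[OF fin]) simp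
  then obtain T where T_eq: "Max (range (\<lambda>t. card (E t))) = card (E T)" by blast
  have T: "card (E t) \<le> card (E T)" for t
    unfolding T_eq[symmetric] by (rule Max_ge[OF fin]) blast
  have "E t = E T" if "T \<le> t" for t
  proof -
    have "E T \<subseteq> E t" using lift_Suc_mono_le[of E, OF assms(1) that] .
    from card_seteq[OF finite_subset[OF assms(2,3)] this T] show ?thesis by (rule sym)
  qed
  thus ?thesis by (rule that)
qed

text \<open>Induction on the number of balls: after the final load has become constant, the rightmost run is
  peeled off. The shift by \<open>Suc T1\<close> is needed because a load is seen as a run only one move later.\<close>

theorem links_eventually_constant:
  assumes "\<And>t. sweep n B (X t) (X (Suc t))"
  shows "\<exists>T. \<forall>t\<ge>T. links n (X t) = links n (X T)"
  using assms
proof (induction "card B" arbitrary: B X rule: less_induct)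
  case less
  note sw = less.prems
  have arr: "arrangement n B (X t)" for t by (rule sweep.before[OF sw])
  have finB: "finite B" using arrangement_labels[OF arr] finite_subset by blast
  show ?case
  proof (cases "B = {}")
    case True
    have "links n (X t) = {}" for t
      using arrangement_cases[OF arr[of t]] True by (auto simp: links_def)
    thus ?thesis by simp
  next
    case False
    define E where "E t = final_load n (X t) (X (Suc t))" for t
    have "E t \<subseteq> E (Suc t)" for t
      unfolding E_def by (rule final_load_mono[OF sw sw False])
    moreover have "E t \<subseteq> B" for t unfolding E_def by (rule sweep.final_load_subset[OF sw])
    ultimately obtain T1 where T1: "\<And>t. T1 \<le> t \<Longrightarrow> E t = E T1"
      using subset_chain_stabilizes[of E B] finB by blast
    define xs where "xs = sorted_list_of_set (E T1)"
    have "finite (E T1)" unfolding E_def by (rule sweep.final_load_finite[OF sw])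
    hence S: "set xs = E T1" "length xs = card (E T1)" by (simp_all add: xs_def)
    define Y where "Y t = remove_balls n (set xs) (X (Suc T1 + t))" for t
    have ew: "ends_with n (X (Suc t)) (front n (X t)) xs" if "T1 \<le> t" for t
      using sweep.after_ends_with[OF sw False, of t] T1[OF that] by (simp add: xs_def E_def)
    have "sweep n (B - set xs) (Y t) (Y (Suc t))" for t
    proof -
      have "front n (X (Suc (T1 + t))) = front n (X (T1 + t)) + int (length xs)"
        using sweep.front_after[OF sw False, of "T1 + t"] T1[of "T1 + t"] S(2) by (simp add: E_def)
      moreover have "final_load n (X (Suc (T1 + t))) (X (Suc (Suc (T1 + t)))) = set xs"
        using T1[of "Suc (T1 + t)"] S(1) by (simp add: E_def)
      ultimately have "in_flight n (X (Suc (T1 + t))) (X (Suc (Suc (T1 + t))))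
          (front n (X (T1 + t)) + int (length xs)) = set xs"
        by (simp add: final_load_def)
      from sweep.sweep_remove[OF sw ew this] show ?thesis by (simp add: Y_def)
    qed
    moreover have "card (B - set xs) < card B"
    proof (rule psubset_card_mono[OF finB])
      have "E T1 \<noteq> {}" using sweep.front_in_final_load[OF sw False, of T1] by (auto simp: E_def)
      moreover have "E T1 \<subseteq> B" unfolding E_def by (rule sweep.final_load_subset[OF sw])
      ultimately show "B - set xs \<subset> B" using S(1) by blast
    qed
    ultimately obtain T where T: "\<And>t. T \<le> t \<Longrightarrow> links n (Y t) = links n (Y T)"
      using less.hyps[of "B - set xs" Y] by blast
    have "links n (X t) = links n (X (Suc T1 + T))" if "Suc T1 + T \<le> t" for t
    proof -
      have split: "links n (X (Suc T1 + k)) =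
          links n (Y k) \<union> {(xs ! j, xs ! Suc j) | j. Suc j < length xs}" for k
        using links_remove[OF arr ew[of "T1 + k"]] by (simp add: Y_def)
      have t: "Suc T1 + (t - Suc T1) = t" "T \<le> t - Suc T1" using that by auto
      show ?thesis using split[of "t - Suc T1"] unfolding t(1) T[OF t(2)] split[of T] .
    qed
    thus ?thesis by blast
  qed
qed

section \<open>Increasing runs and links\<close>

lemma block_links:
  assumes "increasing_block n X p xs" "p \<le> i" "i + 1 < p + int (length xs)"
  shows "(X i, X (i + 1)) \<in> links n X"
proof -
  define j where "j = nat (i - p)"
  have at: "\<And>j. j < length xs \<Longrightarrow> X (p + int j) = xs ! j" and xs: "sorted_wrt (<) xs" "set xs \<subseteq> {1..n}"
    using assms(1) by (auto simp: increasing_block_def)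
  have j: "i = p + int j" "Suc j < length xs" using assms(2,3) by (auto simp: j_def)
  have "X i = xs ! j" using at[of j] j by simp
  moreover have "X (i + 1) = xs ! Suc j" using at[of "Suc j"] j by (simp add: algebra_simps)
  moreover have "xs ! j < xs ! Suc j" using sorted_wrt_nth_less[OF xs(1), of j "Suc j"] j(2) by simp
  moreover have "xs ! Suc j \<le> n" using xs(2) nth_mem[OF j(2)] by auto
  ultimately show ?thesis unfolding links_def by auto
qed

text \<open>Maximality needs to be tested only against one more box on either side.\<close>

lemma increasing_run_at_iff:
  assumes arr: "arrangement n {1..n} X"
  shows "increasing_run_at n X p xs \<longleftrightarrow> increasing_block n X p xs \<and>
    (X (p - 1), X p) \<notin> links n X \<and>
    (X (p + int (length xs) - 1), X (p + int (length xs))) \<notin> links n X"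
    (is "_ \<longleftrightarrow> ?R")
proof
  assume run: "increasing_run_at n X p xs"
  hence block: "increasing_block n X p xs"
    and max: "\<And>q ys. increasing_block n X q ys \<Longrightarrow>
      {p..<p + int (length xs)} \<subseteq> {q..<q + int (length ys)} \<Longrightarrow> q = p \<and> ys = xs"
    by (auto simp: increasing_run_at_def)
  have xs: "xs \<noteq> []" "set xs \<subseteq> {1..n}" "sorted_wrt (<) xs"
    "\<And>j. j < length xs \<Longrightarrow> X (p + int j) = xs ! j"
    using block by (auto simp: increasing_block_def)
  have ball: "a \<in> {1..n}" if "(a, b) \<in> links n X \<or> (b, a) \<in> links n X" for a b
    using that arrangement_ball[OF arr] by (auto simp: links_def)
  have "(X (p - 1), X p) \<notin> links n X"
  proof
    assume link: "(X (p - 1), X p) \<in> links n X"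
    have "increasing_block n X (p - 1) (X (p - 1) # xs)"
      unfolding increasing_block_def
    proof (intro conjI allI impI)
      show "set (X (p - 1) # xs) \<subseteq> {1..n}" using ball link xs(2) by auto
      have "X (p - 1) < xs ! 0" using link xs(4)[of 0] xs(1) by (auto simp: links_def)
      moreover have "xs ! 0 \<le> y" if "y \<in> set xs" for y
        using that xs(3) by (cases xs) auto
      ultimately show "sorted_wrt (<) (X (p - 1) # xs)" using xs(3) by fastforce
      fix j assume "j < length (X (p - 1) # xs)"
      thus "X (p - 1 + int j) = (X (p - 1) # xs) ! j"
        using xs(4)[of "j - 1"] by (cases j) (auto simp: algebra_simps)
    qed simp
    from max[OF this] show False by simp
  qed
  moreover have "(X (p + int (length xs) - 1), X (p + int (length xs))) \<notin> links n X"
  proof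
    let ?q = "p + int (length xs)"
    assume link: "(X (?q - 1), X ?q) \<in> links n X"
    have "increasing_block n X p (xs @ [X ?q])"
      unfolding increasing_block_def
    proof (intro conjI allI impI)
      show "set (xs @ [X ?q]) \<subseteq> {1..n}" using ball link xs(2) by auto
      have "X (?q - 1) = last xs"
      proof -
        have q: "?q - 1 = p + int (length xs - 1)" using xs(1) by (simp add: Suc_le_eq of_nat_diff)
        show ?thesis unfolding q last_conv_nth[OF xs(1)] by (rule xs(4)) (use xs(1) in simp)
      qed
      hence "last xs < X ?q" using link by (auto simp: links_def)
      moreover have "y \<le> last xs" if y: "y \<in> set xs" for y
      proof -
        obtain i where i: "i < length xs" "y = xs ! i" using y by (auto simp: in_set_conv_nth)
        hence "i = length xs - 1 \<or> i < length xs - 1" by auto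
        thus ?thesis using sorted_wrt_nth_less[OF xs(3), of i "length xs - 1"] i xs(1)
          by (auto simp: last_conv_nth)
      qed
      ultimately show "sorted_wrt (<) (xs @ [X ?q])" using xs(3) by (fastforce simp: sorted_wrt_append)
      fix j assume "j < length (xs @ [X ?q])"
      thus "X (p + int j) = (xs @ [X ?q]) ! j"
        using xs(4)[of j] by (cases "j < length xs") (auto simp: nth_append less_Suc_eq)
    qed simp
    from max[OF this] show False by simp
  qed
  ultimately show ?R using block by blast
next
  assume R: ?R
  hence block: "increasing_block n X p xs" by blast
  hence xs: "xs \<noteq> []" "\<And>j. j < length xs \<Longrightarrow> X (p + int j) = xs ! j"
    by (auto simp: increasing_block_def)
  show "increasing_run_at n X p xs"
    unfolding increasing_run_at_def
  proof (intro conjI allI impI)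
    show "increasing_block n X p xs" by fact
    fix q ys
    assume "increasing_block n X q ys \<and> {p..<p + int (length xs)} \<subseteq> {q..<q + int (length ys)}"
    hence bl: "increasing_block n X q ys" and sub: "{p..<p + int (length xs)} \<subseteq> {q..<q + int (length ys)}"
      by auto
    have ys: "\<And>j. j < length ys \<Longrightarrow> X (q + int j) = ys ! j"
      using bl by (auto simp: increasing_block_def)
    have "p \<in> {p..<p + int (length xs)}" "p + int (length xs) - 1 \<in> {p..<p + int (length xs)}"
      using xs(1) by (auto simp: Suc_le_eq)
    hence "p \<in> {q..<q + int (length ys)}" "p + int (length xs) - 1 \<in> {q..<q + int (length ys)}"
      using sub by blast+
    hence ends: "q \<le> p" "p < q + int (length ys)" "p + int (length xs) \<le> q + int (length ys)" by auto
    have qp: "q = p"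
    proof (rule ccontr)
      assume "q \<noteq> p"
      hence "(X (p - 1), X (p - 1 + 1)) \<in> links n X" using ends by (intro block_links[OF bl]) auto
      with R show False by simp
    qed
    have "length ys = length xs"
    proof (rule ccontr)
      assume "length ys \<noteq> length xs"
      hence "(X (p + int (length xs) - 1), X (p + int (length xs) - 1 + 1)) \<in> links n X"
        using ends qp xs(1) by (intro block_links[OF bl]) (auto simp: Suc_le_eq)
      with R show False by simp
    qed
    hence "ys = xs" using xs(2) ys qp by (intro nth_equalityI) auto
    with qp show "q = p" "ys = xs" by auto
  qed
qed

lemma run_at_unique:
  assumes arr: "arrangement n {1..n} X"
    and "increasing_run_at n X p xs" "increasing_run_at n X q ys"
    and "p \<le> i" "i < p + int (length xs)" "q \<le> i" "i < q + int (length ys)"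
  shows "p = q \<and> xs = ys"
proof -
  note R = assms(2,3)[unfolded increasing_run_at_iff[OF arr]]
  have le: "\<not> a < b" if "increasing_block n X a as" "a \<le> i" "i < a + int (length as)"
    "(X (b - 1), X b) \<notin> links n X" "b \<le> i" for a b as
    using block_links[OF that(1), of "b - 1"] that by auto
  have "p = q" using le[of p xs q] le[of q ys p] R assms(4-7) by fastforce
  have len: "\<not> length as < length bs" if "increasing_block n X p bs" "as \<noteq> []"
    "(X (p + int (length as) - 1), X (p + int (length as))) \<notin> links n X" for as bs
    using block_links[OF that(1), of "p + int (length as) - 1"] that(2,3) by (auto simp: Suc_le_eq)
  have ne: "xs \<noteq> []" "ys \<noteq> []" using R by (auto simp: increasing_block_def)
  have "length xs = length ys"
    using len[of ys xs] len[of xs ys] R ne \<open>p = q\<close> by fastforce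
  moreover have "X (p + int j) = xs ! j" "X (p + int j) = ys ! j" if "j < length xs" for j
    using R that \<open>p = q\<close> \<open>length xs = length ys\<close> by (auto simp: increasing_block_def)
  ultimately have "xs = ys" by (intro nth_equalityI) auto
  with \<open>p = q\<close> show ?thesis by simp
qed

lemma run_at_ball:
  assumes "arrangement n {1..n} X" "increasing_run_at n X p xs" "X i \<in> set xs"
  shows "p \<le> i" "i < p + int (length xs)"
proof -
  obtain j where j: "j < length xs" "X i = xs ! j" using assms(3) by (auto simp: in_set_conv_nth)
  have xs: "set xs \<subseteq> {1..n}" "X (p + int j) = xs ! j"
    using assms(2) j(1) by (auto simp: increasing_run_at_def increasing_block_def)
  have "X i \<le> n" using xs(1) assms(3) by auto
  hence "i = p + int j" using arrangement_inj[OF assms(1), of i "p + int j"] xs(2) j(2) by simp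
  with j(1) show "p \<le> i" "i < p + int (length xs)" by auto
qed

lemma runs_disjoint:
  assumes "arrangement n {1..n} X" "increasing_run n X xs" "increasing_run n X ys"
    "b \<in> set xs" "b \<in> set ys"
  shows "xs = ys"
proof -
  obtain p q where pq: "increasing_run_at n X p xs" "increasing_run_at n X q ys"
    using assms(2,3) by (auto simp: increasing_run_def)
  have "b \<in> {1..n}" using pq(1) assms(4) by (auto simp: increasing_run_at_def increasing_block_def)
  then obtain i where i: "X i = b" using assms(1) unfolding arrangement_def by blast
  show ?thesis
    using run_at_unique[OF assms(1) pq] run_at_ball[OF assms(1) pq(1), of i]
      run_at_ball[OF assms(1) pq(2), of i] assms(4,5) i by blast
qed

text \<open>A longest block containing \<open>b\<close> is maximal with respect to the boxes it occupies.\<close>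

lemma run_through_ball:
  assumes arr: "arrangement n {1..n} X" and b: "b \<in> {1..n}"
  obtains xs where "increasing_run n X xs" "b \<in> set xs"
proof -
  obtain i where i: "X i = b" using arr b unfolding arrangement_def by blast
  define P where "P m \<longleftrightarrow> (\<exists>p xs. increasing_block n X p xs \<and> b \<in> set xs \<and> length xs = m)" for m
  have "P 1"
    unfolding P_def by (rule exI[of _ i], rule exI[of _ "[b]"]) (use i b in \<open>auto simp: increasing_block_def\<close>)
  have bound: "m \<le> n" if m: "P m" for m
  proof -
    obtain p xs where xs: "increasing_block n X p xs" "length xs = m" using m by (auto simp: P_def)
    hence "sorted_wrt (<) xs" "set xs \<subseteq> {1..n}" by (auto simp: increasing_block_def)
    hence "distinct xs" by (simp add: strict_sorted_iff)
    hence "m = card (set xs)" using xs(2) by (simp add: distinct_card)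
    also have "\<dots> \<le> card {1..n}" using \<open>set xs \<subseteq> {1..n}\<close> by (intro card_mono) auto
    finally show ?thesis by simp
  qed
  define m where "m = Greatest P"
  have "P m" unfolding m_def using GreatestI_nat[of P 1 n] \<open>P 1\<close> bound by blast
  then obtain p xs where xs: "increasing_block n X p xs" "b \<in> set xs" "length xs = m"
    by (auto simp: P_def)
  have at: "\<And>j. j < length xs \<Longrightarrow> X (p + int j) = xs ! j" using xs(1) by (auto simp: increasing_block_def)
  have ne: "0 < length xs" using xs(2) by (cases xs) auto
  have "increasing_run_at n X p xs"
    unfolding increasing_run_at_def
  proof (intro conjI allI impI)
    show "increasing_block n X p xs" by (rule xs(1))
    fix q ys
    assume "increasing_block n X q ys \<and> {p..<p + int (length xs)} \<subseteq> {q..<q + int (length ys)}"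
    hence bl: "increasing_block n X q ys" and sub: "{p..<p + int (length xs)} \<subseteq> {q..<q + int (length ys)}"
      by auto
    have aty: "\<And>j. j < length ys \<Longrightarrow> X (q + int j) = ys ! j" using bl by (auto simp: increasing_block_def)
    obtain j where j: "j < length xs" "xs ! j = b" using xs(2) by (auto simp: in_set_conv_nth)
    have "p + int j \<in> {q..<q + int (length ys)}" using sub j(1) by auto
    hence "X (p + int j) = ys ! nat (p + int j - q)" "nat (p + int j - q) < length ys"
      using aty[of "nat (p + int j - q)"] by auto
    hence "b \<in> set ys" using at[OF j(1)] j(2) by auto
    hence "P (length ys)" using bl by (auto simp: P_def)
    hence "length ys \<le> length xs" unfolding xs(3) m_def by (rule Greatest_le_nat[of P _ n]) (use bound in blast)
    moreover have "p \<in> {p..<p + int (length xs)}" "p + int (length xs) - 1 \<in> {p..<p + int (length xs)}"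
      using ne by auto
    hence "p \<in> {q..<q + int (length ys)}" "p + int (length xs) - 1 \<in> {q..<q + int (length ys)}"
      using sub by blast+
    ultimately have "q = p" "length ys = length xs" by auto
    moreover from this have "ys = xs" using at aty by (intro nth_equalityI) auto
    ultimately show "q = p" "ys = xs" by auto
  qed
  thus ?thesis using that xs(2) by (auto simp: increasing_run_def)
qed

text \<open>Starting at the box of its first ball, the links force the run to appear in consecutive boxes of
  \<open>X'\<close>, and the absence of a link into its first or out of its last ball makes it maximal.\<close>

lemma runs_determined_by_links:
  assumes arr: "arrangement n {1..n} X" "arrangement n {1..n} X'"
    and links: "links n X' = links n X" and run: "increasing_run n X xs"
  shows "increasing_run n X' xs"
proof -
  obtain p where "increasing_run_at n X p xs" using run by (auto simp: increasing_run_def)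
  note R = this[unfolded increasing_run_at_iff[OF arr(1)]]
  hence block: "increasing_block n X p xs" by blast
  have xs: "xs \<noteq> []" "set xs \<subseteq> {1..n}" "sorted_wrt (<) xs"
    and at: "\<And>j. j < length xs \<Longrightarrow> X (p + int j) = xs ! j"
    using block by (auto simp: increasing_block_def)
  have len: "0 < length xs" using xs(1) by simp
  have xs_n: "xs ! j \<le> n" if "j < length xs" for j using xs(2) nth_mem[OF that] by auto
  have "xs ! 0 \<in> {1..n}" using xs(2) nth_mem[OF len] by blast
  then obtain p' where p': "X' p' = xs ! 0" using arr(2) unfolding arrangement_def by blast
  have at': "j < length xs \<Longrightarrow> X' (p' + int j) = xs ! j" for j
  proof (induction j)
    case 0
    thus ?case using p' by simp
  next
    case (Suc j)
    have "(X (p + int j), X (p + int j + 1)) \<in> links n X'"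
      unfolding links by (rule block_links[OF block]) (use Suc.prems in auto)
    moreover have "X (p + int j) = xs ! j" using at[of j] Suc.prems by simp
    moreover have "X (p + int j + 1) = xs ! Suc j" using at[of "Suc j"] Suc.prems by (simp add: algebra_simps)
    ultimately obtain i where i: "X' i = xs ! j" "X' (i + 1) = xs ! Suc j" by (auto simp: links_def)
    have "i = p' + int j"
      using arrangement_inj[OF arr(2), of i "p' + int j"] Suc i(1) xs_n[of j] by simp
    with i(2) show ?case by (simp add: algebra_simps)
  qed
  have "increasing_block n X' p' xs" using xs at' by (simp add: increasing_block_def)
  moreover have "(X' (p' - 1), X' p') \<notin> links n X'"
  proof
    assume "(X' (p' - 1), X' p') \<in> links n X'"
    then obtain i where i: "X (i + 1) = xs ! 0" "X i < X (i + 1)" "X (i + 1) \<le> n"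
      unfolding links p' by (fastforce simp: links_def)
    have "i + 1 = p" using arrangement_inj[OF arr(1), of "i + 1" p] i at[OF len] by simp
    hence "i = p - 1" "i + 1 = p" by auto
    moreover have "(X i, X (i + 1)) \<in> links n X" unfolding links_def using i(2,3) by blast
    ultimately have "(X (p - 1), X p) \<in> links n X" by (simp only:)
    with R show False by blast
  qed
  moreover have "(X' (p' + int (length xs) - 1), X' (p' + int (length xs))) \<notin> links n X'"
  proof
    let ?l = "length xs - 1"
    have l: "?l < length xs" using len by simp
    have q: "p + int (length xs) - 1 = p + int ?l" "p' + int (length xs) - 1 = p' + int ?l"
      using len by (simp_all add: Suc_le_eq of_nat_diff)
    assume "(X' (p' + int (length xs) - 1), X' (p' + int (length xs))) \<in> links n X'"
    then obtain i where i: "X i = xs ! ?l" "X i < X (i + 1)" "X (i + 1) \<le> n"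
      unfolding links q at'[OF l] by (auto simp: links_def)
    have "i = p + int ?l" using arrangement_inj[OF arr(1), of i "p + int ?l"] i at[OF l] by simp
    hence ends: "p + int (length xs) - 1 = i" using q(1) by (simp only:)
    hence "p + int (length xs) = i + 1" by linarith
    note ends this
    moreover have "(X i, X (i + 1)) \<in> links n X" unfolding links_def using i(2,3) by blast
    ultimately have "(X (p + int (length xs) - 1), X (p + int (length xs))) \<in> links n X" by (simp only:)
    with R show False by blast
  qed
  ultimately show ?thesis
    using increasing_run_at_iff[OF arr(2)] by (auto simp: increasing_run_def)
qed

lemma ends_with_run:
  assumes "arrangement n {1..n} X" "ends_with n X a xs" "xs \<noteq> []" "set xs \<subseteq> {1..n}"
  shows "increasing_run n X xs"
proof -
  note E = assms(2)[unfolded ends_with_def]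
  have "increasing_block n X (a + 1) xs" using E assms(3,4) by (simp add: increasing_block_def)
  moreover have "(X (a + 1 - 1), X (a + 1)) \<notin> links n X" using E by (auto simp: links_def)
  moreover have "X (a + 1 + int (length xs)) = n + 1" using E by simp
  hence "(X (a + 1 + int (length xs) - 1), X (a + 1 + int (length xs))) \<notin> links n X"
    by (auto simp: links_def)
  ultimately show ?thesis
    using increasing_run_at_iff[OF assms(1)] by (auto simp: increasing_run_def)
qed

section \<open>Reading off the soliton decomposition\<close>

definition trajectory :: "nat \<Rightarrow> (nat \<Rightarrow> nat) \<Rightarrow> nat \<Rightarrow> config" where
  "trajectory n w t = (BB n ^^ t) (config_of_perm n w)"

lemma soliton_trajectory:
  "soliton n (trajectory n w t) xs \<longleftrightarrow> (\<forall>s. increasing_run n (trajectory n w (s + t)) xs)"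
  by (simp add: soliton_def trajectory_def funpow_add)

lemma arrangement_perm:
  assumes "w permutes {1..n}"
  shows "arrangement n {1..n} (config_of_perm n w)"
  unfolding arrangement_def
proof (intro conjI ballI subset_refl)
  show "range (config_of_perm n w) \<subseteq> insert (n + 1) {1..n}"
  proof (rule image_subsetI)
    fix i show "config_of_perm n w i \<in> insert (n + 1) {1..n}"
      using permutes_in_image[OF assms, of "nat i"] by (auto simp: config_of_perm_def)
  qed
  fix b assume b: "b \<in> {1..n}"
  then obtain a where a: "a \<in> {1..n}" "w a = b" using permutes_image[OF assms] by (metis imageE)
  show "\<exists>!i. config_of_perm n w i = b"
  proof (rule ex1I[of _ "int a"])
    show "config_of_perm n w (int a) = b" using a by (simp add: config_of_perm_def)
    fix i assume i: "config_of_perm n w i = b"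
    have range: "1 \<le> i \<and> i \<le> int n" and "w (nat i) = w a"
      using i a b by (auto simp: config_of_perm_def split: if_splits)
    hence "nat i = a" using permutes_inj[OF assms] by (simp add: inj_eq)
    with range show "i = int a" by linarith
  qed
qed

lemma arrangement_trajectory:
  assumes "w permutes {1..n}"
  shows "arrangement n {1..n} (trajectory n w t)"
proof (induction t)
  case 0
  thus ?case using arrangement_perm[OF assms] by (simp add: trajectory_def)
next
  case (Suc t)
  thus ?case using sweep.after[OF BB_sweep[OF Suc]] by (simp add: trajectory_def)
qed

lemma sweep_trajectory:
  assumes "w permutes {1..n}"
  shows "sweep n {1..n} (trajectory n w t) (trajectory n w (Suc t))"
  using BB_sweep[OF arrangement_trajectory[OF assms, of t]] by (simp add: trajectory_def)

text \<open>As soon as the links are stationary, every run is a soliton.\<close>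

lemma is_SD_exists:
  assumes "w permutes {1..n}"
  shows "\<exists>T. is_SD n w T"
proof -
  let ?X = "trajectory n w"
  note arr = arrangement_trajectory[OF assms]
  obtain t where t: "\<And>s. t \<le> s \<Longrightarrow> links n (?X s) = links n (?X t)"
    using links_eventually_constant[of n "{1..n}" ?X, OF sweep_trajectory[OF assms]] by blast
  have soliton: "soliton n (?X t) xs \<longleftrightarrow> increasing_run n (?X t) xs" for xs
  proof
    assume "soliton n (?X t) xs"
    thus "increasing_run n (?X t) xs" unfolding soliton_trajectory by (metis add_0)
  next
    assume run: "increasing_run n (?X t) xs"
    have "increasing_run n (?X (s + t)) xs" for s
      by (rule runs_determined_by_links[OF arr arr t run]) simp
    thus "soliton n (?X t) xs" unfolding soliton_trajectory by blast
  qed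
  define P where "P = {p. \<exists>xs. increasing_run_at n (?X t) p xs}"
  have "?X t p \<le> n" if p: "p \<in> P" for p
  proof -
    obtain xs where "increasing_block n (?X t) p xs"
      using p by (auto simp: P_def increasing_run_at_def)
    hence xs: "xs \<noteq> []" "set xs \<subseteq> {1..n}" "\<And>j. j < length xs \<Longrightarrow> ?X t (p + int j) = xs ! j"
      by (auto simp: increasing_block_def)
    have "xs ! 0 \<in> {1..n}" using xs(1,2) by (metis length_greater_0_conv nth_mem subsetD)
    thus ?thesis using xs(3)[of 0] xs(1) by simp
  qed
  hence fin: "finite P" by (intro finite_subset[OF _ arrangement_finite[OF arr[of t]]]) auto
  define run where "run p = (SOME xs. increasing_run_at n (?X t) p xs)" for p
  have run: "increasing_run_at n (?X t) p (run p)" if "p \<in> P" for p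
    using that someI_ex[of "increasing_run_at n (?X t) p"] by (simp add: P_def run_def)
  define ps where "ps = rev (sorted_list_of_set P)"
  define T where "T = map run ps"
  have ps: "set ps = P" "sorted_wrt (>) ps"
    using fin by (simp_all add: ps_def sorted_wrt_rev)
  have "set T = {xs. soliton n (?X t) xs}"
  proof (intro equalityI subsetI)
    fix xs assume "xs \<in> set T"
    then obtain p where "p \<in> P" "xs = run p" using ps by (auto simp: T_def)
    thus "xs \<in> {xs. soliton n (?X t) xs}" using run soliton by (auto simp: increasing_run_def)
  next
    fix xs assume "xs \<in> {xs. soliton n (?X t) xs}"
    then obtain p where p: "increasing_run_at n (?X t) p xs" using soliton by (auto simp: increasing_run_def)
    hence "p \<in> P" by (auto simp: P_def)
    have "increasing_block n (?X t) p xs" "increasing_block n (?X t) p (run p)"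
      using p run[OF \<open>p \<in> P\<close>] by (auto simp: increasing_run_at_def)
    hence "xs \<noteq> []" "run p \<noteq> []" by (auto simp: increasing_block_def)
    hence "xs = run p" using run_at_unique[OF arr p run[OF \<open>p \<in> P\<close>], of p] by simp
    thus "xs \<in> set T" using \<open>p \<in> P\<close> ps by (auto simp: T_def)
  qed
  moreover have "\<forall>i<length T. increasing_run_at n (?X t) (ps ! i) (T ! i)"
  proof (intro allI impI)
    fix i assume "i < length T"
    hence i: "i < length ps" by (simp add: T_def)
    hence "ps ! i \<in> P" using ps(1) nth_mem by blast
    thus "increasing_run_at n (?X t) (ps ! i) (T ! i)" using run i by (simp add: T_def)
  qed
  ultimately have "solitons_right_to_left n (?X t) T"
    unfolding solitons_right_to_left_def using ps(2) by (auto simp: T_def intro!: exI[of _ ps])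
  moreover have "steady_state n (?X t)"
    unfolding steady_state_def soliton using run_through_ball[OF arr] by metis
  ultimately show ?thesis unfolding is_SD_def Let_def trajectory_def by blast
qed

lemma final_load_trajectory_mono:
  assumes "w permutes {1..n}" "n \<ge> 1"
  shows "final_load n (trajectory n w 0) (trajectory n w (Suc 0))
    \<subseteq> final_load n (trajectory n w t) (trajectory n w (Suc t))"
proof (induction t)
  case (Suc t)
  have "final_load n (trajectory n w t) (trajectory n w (Suc t))
    \<subseteq> final_load n (trajectory n w (Suc t)) (trajectory n w (Suc (Suc t)))"
    using assms by (intro final_load_mono[OF sweep_trajectory sweep_trajectory]) auto
  with Suc show ?case by blast
qed simp

lemma final_load_ge_increasing_subsequence:
  assumes w: "w permutes {1..n}" and n: "n \<ge> 1" and S: "S \<subseteq> {1..n}" "strict_mono_on S w"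
  shows "card S \<le> card (final_load n (trajectory n w 0) (trajectory n w (Suc 0)))"
proof -
  let ?X = "trajectory n w 0"
  interpret sweep n "{1..n}" ?X "trajectory n w (Suc 0)" by (rule sweep_trajectory[OF w])
  have X: "?X i = (if 1 \<le> i \<and> i \<le> int n then w (nat i) else n + 1)" for i
    by (simp add: trajectory_def config_of_perm_def)
  have wn: "w i \<le> n" if "1 \<le> i" "i \<le> n" for i
    using permutes_in_image[OF w, of i] that by auto
  have front: "front n ?X = int n"
    unfolding front_def
  proof (rule Max_eqI)
    show "int n \<in> {i. ?X i \<le> n}" using n wn[of n] by (simp add: X)
    show "i \<le> int n" if "i \<in> {i. ?X i \<le> n}" for i
      using that by (simp add: X split: if_splits)
  qed (rule arrangement_finite[OF before])
  have "strict_mono_on (int ` S) ?X"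
  proof (rule strict_mono_onI)
    fix r s assume "r \<in> int ` S" "s \<in> int ` S" "r < s"
    then obtain a b where ab: "a \<in> S" "b \<in> S" "r = int a" "s = int b" "a < b" by auto
    moreover have "w a < w b" using strict_mono_onD[OF S(2)] ab by blast
    moreover have "1 \<le> a" "b \<le> n" using ab S(1) by auto
    ultimately show "?X r < ?X s" by (simp add: X)
  qed
  hence "card (int ` S \<inter> {0<..0 + int n}) \<le> card {c \<in> carrier (0 + int n). c \<le> n}"
    using wn by (intro increasing_subsequence_load) (auto simp: X)
  also have "int ` S \<inter> {0<..0 + int n} = int ` S" using S(1) by auto
  also have "card (int ` S) = card S" by (simp add: card_image)
  also have "{c \<in> carrier (0 + int n). c \<le> n} = final_load n ?X (trajectory n w (Suc 0))"
    using carrier_le by (auto simp: final_load_def front)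
  finally show ?thesis .
qed

lemma card_links_perm:
  "card (links n (config_of_perm n w)) \<le> card {i \<in> {1..<n}. w i < w (i + 1)}"
proof -
  have "links n (config_of_perm n w) \<subseteq> (\<lambda>i. (w i, w (i + 1))) ` {i \<in> {1..<n}. w i < w (i + 1)}"
  proof
    fix z assume "z \<in> links n (config_of_perm n w)"
    then obtain i where i: "z = (config_of_perm n w i, config_of_perm n w (i + 1))"
      "config_of_perm n w i < config_of_perm n w (i + 1)" "config_of_perm n w (i + 1) \<le> n"
      by (auto simp: links_def)
    hence "1 \<le> i" "i + 1 \<le> int n" by (auto simp: config_of_perm_def split: if_splits)
    moreover from this have "nat (i + 1) = nat i + 1" by simp
    ultimately have "z = (w (nat i), w (nat i + 1))" "w (nat i) < w (nat i + 1)" "nat i \<in> {1..<n}"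
      using i by (auto simp: config_of_perm_def)
    thus "z \<in> (\<lambda>i. (w i, w (i + 1))) ` {i \<in> {1..<n}. w i < w (i + 1)}" by blast
  qed
  thus ?thesis by (intro surj_card_le) auto
qed

lemma card_links_trajectory:
  assumes "w permutes {1..n}"
  shows "card (links n (trajectory n w t)) = card (links n (config_of_perm n w))"
proof (induction t)
  case (Suc t)
  thus ?case using sweep.card_links_eq[OF sweep_trajectory[OF assms, of t]] by simp
qed (simp add: trajectory_def)

lemma sum_list_lower_bound:
  assumes "\<And>y. y \<in> set ys \<Longrightarrow> 1 \<le> (y :: nat)"
  shows "length ys \<le> sum_list ys" "sum_list ys \<le> length ys \<Longrightarrow> ys = replicate (length ys) 1"
proof -
  have "length ys \<le> sum_list ys \<and> (sum_list ys \<le> length ys \<longrightarrow> ys = replicate (length ys) 1)"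
    using assms
  proof (induction ys)
    case (Cons y ys)
    hence "1 \<le> y" "length ys \<le> sum_list ys" "sum_list ys \<le> length ys \<longrightarrow> ys = replicate (length ys) 1"
      by auto
    thus ?case by auto
  qed simp
  thus "length ys \<le> sum_list ys" "sum_list ys \<le> length ys \<Longrightarrow> ys = replicate (length ys) 1" by auto
qed

text \<open>Let \<open>t\<close> be a time of steady state. The first balls of the rows include all balls into which no
  link leads, which gives more than \<open>n - card S\<close> rows. For the top row no late time is needed: the last ball at time
  \<open>t\<close> lies in the rightmost soliton, and also in the rightmost run at time \<open>t + 1\<close>. Since a soliton
  is still a run at time \<open>t + 1\<close>, the two agree, and that run has at least \<open>card S\<close> balls.\<close>

theorem SD_shape_of_long_increasing_subsequence:
  assumes w: "w permutes {1..n}" and n: "n \<ge> 1" and S: "S \<subseteq> {1..n}" "strict_mono_on S w"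
    and ascents: "card {i \<in> {1..<n}. w i < w (i + 1)} < card S" and SD: "is_SD n w T"
  shows "shape T = card S # replicate (n - card S) 1"
proof -
  let ?X = "trajectory n w"
  note arr = arrangement_trajectory[OF w] and sw = sweep_trajectory[OF w]
  have ne: "{1..n} \<noteq> {}" using n by simp
  obtain t where steady: "steady_state n (?X t)" and T: "solitons_right_to_left n (?X t) T"
    using SD by (auto simp: is_SD_def Let_def trajectory_def)
  obtain ps where ps: "length ps = length T" "sorted_wrt (>) ps"
    "\<And>i. i < length T \<Longrightarrow> increasing_run_at n (?X t) (ps ! i) (T ! i)"
    and setT: "set T = {xs. soliton n (?X t) xs}"
    using T by (auto simp: solitons_right_to_left_def)
  have runs: "increasing_run n (?X (s + t)) xs" if "xs \<in> set T" for xs s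
    using that setT soliton_trajectory by auto
  have run: "increasing_run n (?X t) xs" if "xs \<in> set T" for xs using runs[OF that, of 0] by simp
  have xs: "xs \<noteq> []" "set xs \<subseteq> {1..n}" "distinct xs" if "xs \<in> set T" for xs
    using run[OF that]
    by (auto simp: increasing_run_def increasing_run_at_def increasing_block_def strict_sorted_iff)
  have cover: "\<exists>xs\<in>set T. b \<in> set xs" if "b \<in> {1..n}" for b
    using steady that setT by (auto simp: steady_state_def)
  have nonempty_run: "ps ! i < ps ! i + int (length (T ! i))" if "i < length T" for i
    using xs(1)[OF nth_mem[OF that]] by simp

  have rows: "n < length T + card S"
  proof -
    have "{1..n} - snd ` links n (?X t) \<subseteq> hd ` set T"
    proof
      fix b assume b: "b \<in> {1..n} - snd ` links n (?X t)"
      then obtain xs where xsT: "xs \<in> set T" "b \<in> set xs" using cover by blast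
      obtain p where "increasing_run_at n (?X t) p xs" using run[OF xsT(1)] by (auto simp: increasing_run_def)
      hence block: "increasing_block n (?X t) p xs" by (simp add: increasing_run_at_def)
      hence at: "\<And>j. j < length xs \<Longrightarrow> ?X t (p + int j) = xs ! j" by (auto simp: increasing_block_def)
      obtain j where j: "j < length xs" "b = xs ! j" using xsT(2) by (auto simp: in_set_conv_nth)
      have "j = 0"
      proof (rule ccontr)
        assume "j \<noteq> 0"
        hence "(?X t (p + int j - 1), ?X t (p + int j - 1 + 1)) \<in> links n (?X t)"
          using j(1) by (intro block_links[OF block]) auto
        hence "b \<in> snd ` links n (?X t)" using at[OF j(1)] j(2) by force
        with b show False by blast
      qed
      hence "b = hd xs" using j by (simp add: hd_conv_nth)
      with xsT(1) show "b \<in> hd ` set T" by blast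
    qed
    hence "card ({1..n} - snd ` links n (?X t)) \<le> card (hd ` set T)" by (intro card_mono) auto
    also have "\<dots> \<le> length T" using card_image_le[of "set T" hd] card_length[of T] by simp
    finally have "n - card (snd ` links n (?X t)) \<le> length T"
      using diff_card_le_card_Diff[of "snd ` links n (?X t)" "{1..n}"] card_links(1)[OF arr] by simp
    moreover have "card (snd ` links n (?X t)) \<le> card (links n (?X t))"
      by (rule card_image_le) (rule card_links(1)[OF arr])
    moreover have "card (links n (?X t)) < card S"
      using card_links_trajectory[OF w, of t] card_links_perm[of n w] ascents by simp
    ultimately show ?thesis by linarith
  qed

  \<comment> \<open>A repeated row would put its first ball into two different boxes.\<close>
  have distinct_T: "distinct T"
    unfolding distinct_conv_nth
  proof (intro allI impI)
    fix i j assume ij: "i < length T" "j < length T" "i \<noteq> j"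
    show "T ! i \<noteq> T ! j"
    proof
      assume eq: "T ! i = T ! j"
      have "increasing_block n (?X t) (ps ! i) (T ! i)" "increasing_block n (?X t) (ps ! j) (T ! j)"
        using ps(3) ij by (auto simp: increasing_run_at_def)
      moreover have "T ! i \<noteq> []" using xs(1) ij(1) by simp
      moreover have "T ! i ! 0 \<in> {1..n}"
        using xs(2)[OF nth_mem[OF ij(1)]] \<open>T ! i \<noteq> []\<close> by (metis length_greater_0_conv nth_mem subsetD)
      ultimately have "?X t (ps ! i) = ?X t (ps ! j)" "?X t (ps ! i) \<le> n"
        using eq by (force simp: increasing_block_def)+
      hence "ps ! i = ps ! j" by (rule arrangement_inj[OF arr])
      moreover have "distinct ps" using ps(2) strict_sorted_iff[of "rev ps"] by (simp add: sorted_wrt_rev)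
      ultimately show False using ij ps(1) by (simp add: nth_eq_iff_index_eq)
    qed
  qed
  have "distinct (concat T)"
    using distinct_T xs(3) runs_disjoint[OF arr run run] by (intro distinct_concat) blast+
  hence "length (concat T) = card (set (concat T))" by (rule distinct_card[symmetric])
  also have "\<dots> \<le> card {1..n}" using xs(2) by (intro card_mono) auto
  finally have total: "sum_list (map length T) \<le> n" by (simp add: length_concat)

  have "T \<noteq> []" using cover[of 1] n by auto
  define E where "E = final_load n (?X t) (?X (Suc t))"
  have E: "card S \<le> card E" "finite E"
  proof -
    show "finite E" unfolding E_def by (rule sweep.final_load_finite[OF sw])
    thus "card S \<le> card E"
      using final_load_ge_increasing_subsequence[OF w n S] final_load_trajectory_mono[OF w n, of t]
        card_mono unfolding E_def by (meson le_trans)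
  qed
  have first: "card S \<le> length (hd T)"
  proof -
    let ?q = "front n (?X t)"
    have q: "?X t ?q \<le> n" by (rule front_ball[OF arr ne])
    obtain x where "x \<in> set T" "?X t ?q \<in> set x"
      using cover[of "?X t ?q"] arrangement_ball[OF arr q] by blast
    then obtain i where i: "i < length T" "?X t ?q \<in> set (T ! i)" by (auto simp: in_set_conv_nth)
    note pi = run_at_ball[OF arr ps(3)[OF i(1)] i(2)]
    \<comment> \<open>A row further to the right would have to start inside this one, which contains the last ball.\<close>
    have "i = 0"
    proof (rule ccontr)
      assume "i \<noteq> 0"
      hence lt: "ps ! i < ps ! 0" using sorted_wrt_nth_less[OF ps(2), of 0 i] i(1) ps(1) by simp
      have T0: "0 < length T" using i(1) by linarith
      have "?X t (ps ! 0) \<le> n"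
      proof -
        have bl: "increasing_block n (?X t) (ps ! 0) (T ! 0)"
          using ps(3)[OF T0] by (simp add: increasing_run_at_def)
        hence "?X t (ps ! 0) = T ! 0 ! 0" using xs(1)[OF nth_mem[OF T0]] by (force simp: increasing_block_def)
        moreover have "T ! 0 ! 0 \<in> {1..n}"
          using xs(1,2)[OF nth_mem[OF T0]] by (metis length_greater_0_conv nth_mem subsetD)
        ultimately show ?thesis by simp
      qed
      hence "ps ! 0 \<le> ?q" using beyond_front[OF arr, of t "ps ! 0"] by fastforce
      hence "ps ! 0 = ps ! i"
        using run_at_unique[OF arr ps(3)[OF T0] ps(3)[OF i(1)], of "ps ! 0"] nonempty_run[OF T0] pi lt
        by simp
      with lt show False by simp
    qed
    hence hd: "hd T = T ! 0" "?X t ?q \<in> set (hd T)" "hd T \<in> set T"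
      using i \<open>T \<noteq> []\<close> by (simp_all add: hd_conv_nth)
    have inE: "?X t ?q \<in> E" unfolding E_def by (rule sweep.front_in_final_load[OF sw ne])
    have "increasing_run n (?X (Suc t)) (sorted_list_of_set E)"
    proof (rule ends_with_run[OF arr])
      show "ends_with n (?X (Suc t)) ?q (sorted_list_of_set E)"
        unfolding E_def by (rule sweep.after_ends_with[OF sw ne])
      show "sorted_list_of_set E \<noteq> []" using inE E(2) by (metis empty_iff list.set(1) set_sorted_list_of_set)
      show "set (sorted_list_of_set E) \<subseteq> {1..n}"
        using sweep.final_load_subset[OF sw, of t] E(2) by (simp add: E_def)
    qed
    moreover have "increasing_run n (?X (Suc t)) (hd T)" using runs[OF hd(3), of 1] by simp
    moreover have "?X t ?q \<in> set (sorted_list_of_set E)" using inE E(2) by simp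
    ultimately have "hd T = sorted_list_of_set E" using runs_disjoint[OF arr _ _ hd(2)] by blast
    thus ?thesis using E(1) by simp
  qed

  obtain r rs where T_eq: "map length T = r # rs" using \<open>T \<noteq> []\<close> by (cases T) auto
  have r: "r = length (hd T)" "length T = Suc (length rs)"
    using T_eq by (cases T; auto)+
  have "1 \<le> y" if "y \<in> set rs" for y
  proof -
    have "y \<in> set (map length T)" using that T_eq by simp
    then obtain x where "x \<in> set T" "y = length x" by auto
    thus ?thesis using xs(1)[of x] by (simp add: Suc_le_eq)
  qed
  note bounds = sum_list_lower_bound[of rs, OF this]
  have total': "r + sum_list rs \<le> n" using total T_eq by simp
  have "card S \<le> n" using card_mono[OF _ S(1)] by simp
  have "r = card S" "length rs = n - card S" "sum_list rs \<le> length rs"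
    using total' bounds(1) first rows r \<open>card S \<le> n\<close> by linarith+
  thus ?thesis using bounds(2) T_eq unfolding shape_def by metis
qed

section \<open>Noncrossing involutions\<close>

locale noncrossing =
  fixes n :: nat and w :: "nat \<Rightarrow> nat"
  assumes perm: "w permutes {1..n}" and noncr: "noncrossing_involution w"
begin

definition openers where "openers = {a. a < w a}"
definition closers where "closers = {b. w b < b}"
definition adjacent_openers where "adjacent_openers = {a. w a = a + 1}"
definition fixed_points where "fixed_points = {i \<in> {1..n}. w i = i}"

lemma w_w: "w (w a) = a"
  using noncr by (metis comp_apply id_apply involution_def noncrossing_involution_def)

lemma in_range: "w a \<noteq> a \<Longrightarrow> 1 \<le> a \<and> a \<le> n"
  using permutes_not_in[OF perm, of a] by auto

lemma no_crossing:
  assumes "a < b" "b < c" "c < d" "w a = c" "w b = d"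
  shows False
proof -
  have "w c = a" "w d = b" using assms(4,5) w_w by metis+
  hence "{a, c} \<in> two_cycles w" "{b, d} \<in> two_cycles w"
    unfolding two_cycles_def using assms by (auto intro: less_imp_neq)
  moreover have "crossing {a, c} {b, d}" unfolding crossing_def using assms(1-3) by blast
  ultimately show False using noncr by (simp add: noncrossing_involution_def)
qed

lemma finite_sets: "finite openers" "finite closers" "finite adjacent_openers" "finite fixed_points"
proof -
  have "a \<in> {1..n}" if "w a \<noteq> a" for a using in_range[OF that] by simp
  hence "openers \<subseteq> {1..n}" "closers \<subseteq> {1..n}" "adjacent_openers \<subseteq> {1..n}"
    unfolding openers_def closers_def adjacent_openers_def by fastforce+
  from this[THEN finite_subset[OF _ finite_atLeastAtMost]]
  show "finite openers" "finite closers" "finite adjacent_openers" .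
  show "finite fixed_points" by (simp add: fixed_points_def)
qed

lemma two_cycles_eq: "two_cycles w = (\<lambda>a. {a, w a}) ` openers"
proof (intro equalityI subsetI)
  fix C assume "C \<in> two_cycles w"
  then obtain a b where ab: "C = {a, b}" "a \<noteq> b" "w a = b" "w b = a" by (auto simp: two_cycles_def)
  have "C = {a, w a}" using ab(1,3) by simp
  moreover have "C = {b, w b}" using ab(1,4) by (simp add: insert_commute)
  moreover have "a < w a \<or> b < w b" using ab(2-4) by linarith
  ultimately show "C \<in> (\<lambda>a. {a, w a}) ` openers" unfolding openers_def by blast
next
  fix C assume "C \<in> (\<lambda>a. {a, w a}) ` openers"
  then obtain a where "C = {a, w a}" "a < w a" by (auto simp: openers_def)
  hence "C = {a, w a} \<and> a \<noteq> w a \<and> w a = w a \<and> w (w a) = a" using w_w[of a] by simp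
  thus "C \<in> two_cycles w" unfolding two_cycles_def by blast
qed

lemma inj_cycle: "inj_on (\<lambda>a. {a, w a}) openers"
proof (rule inj_onI)
  fix a b assume "a \<in> openers" "b \<in> openers" "{a, w a} = {b, w b}"
  moreover from this have "a = b \<or> (a = w b \<and> w a = b)" by (simp only: doubleton_eq_iff) blast
  ultimately show "a = b" unfolding openers_def mem_Collect_eq by linarith
qed

lemma card_two_cycles: "card (two_cycles w) = card openers"
  unfolding two_cycles_eq by (rule card_image[OF inj_cycle])

lemma card_adjacent: "card {C \<in> two_cycles w. adjacent C} = card adjacent_openers"
proof -
  have "{C \<in> two_cycles w. adjacent C} = (\<lambda>a. {a, w a}) ` adjacent_openers"
  proof (intro equalityI subsetI)
    fix C assume "C \<in> {C \<in> two_cycles w. adjacent C}"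
    then obtain a i where a: "C = {a, w a}" "a < w a" "{a, w a} = {i, i + 1}"
      unfolding two_cycles_eq openers_def adjacent_def by blast
    hence "a = i \<and> w a = i + 1 \<or> a = i + 1 \<and> w a = i" by (simp only: doubleton_eq_iff)
    hence "w a = a + 1" using a(2) by linarith
    thus "C \<in> (\<lambda>a. {a, w a}) ` adjacent_openers" using a(1) by (simp add: adjacent_openers_def)
  qed (auto simp: two_cycles_eq openers_def adjacent_openers_def adjacent_def)
  moreover have "adjacent_openers \<subseteq> openers" by (auto simp: adjacent_openers_def openers_def)
  ultimately show ?thesis using card_image[OF inj_on_subset[OF inj_cycle]] by simp
qed

lemma card_closers: "card closers = card openers"
proof -
  have "w ` openers = closers"
  proof (intro equalityI subsetI)
    fix b assume "b \<in> closers"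
    thus "b \<in> w ` openers" using w_w[of b] by (intro image_eqI[of _ _ "w b"]) (auto simp: openers_def closers_def)
  qed (auto simp: openers_def closers_def w_w)
  moreover have "inj_on w openers" using permutes_inj[OF perm] inj_on_subset by blast
  ultimately show ?thesis using card_image[of w openers] by simp
qed

lemma card_fixed_points: "n = card fixed_points + 2 * card openers"
proof -
  have "{1..n} = fixed_points \<union> (openers \<union> closers)"
    using in_range by (auto simp: fixed_points_def openers_def closers_def intro: linorder_neqE_nat)
  moreover have "fixed_points \<inter> (openers \<union> closers) = {}" "openers \<inter> closers = {}"
    by (auto simp: fixed_points_def openers_def closers_def)
  ultimately have "card {1..n} = card fixed_points + (card openers + card closers)"
    using finite_sets by (simp add: card_Un_disjoint)
  thus ?thesis by (simp add: card_closers)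
qed

lemma card_adjacent_le: "card adjacent_openers \<le> card openers"
  by (rule card_mono[OF finite_sets(1)]) (auto simp: adjacent_openers_def openers_def)

text \<open>A fixed point \<open>i\<close> has value \<open>i\<close> and the left end \<open>i\<close> of an adjacent cycle has value \<open>i + 1\<close>. In the
  second case the next position \<open>i + 1\<close> is a closer and thus not in the set, so the values increase.\<close>

lemma increasing_subsequence:
  "fixed_points \<union> adjacent_openers \<subseteq> {1..n}"
  "strict_mono_on (fixed_points \<union> adjacent_openers) w"
  "card (fixed_points \<union> adjacent_openers) = n - 2 * card openers + card adjacent_openers"
proof -
  show "fixed_points \<union> adjacent_openers \<subseteq> {1..n}"
    using in_range by (auto simp: fixed_points_def adjacent_openers_def)
  show "strict_mono_on (fixed_points \<union> adjacent_openers) w"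
  proof (rule strict_mono_onI)
    fix a b assume ab: "a \<in> fixed_points \<union> adjacent_openers" "b \<in> fixed_points \<union> adjacent_openers" "a < b"
    have "b \<noteq> a + 1" if "w a = a + 1"
    proof
      assume "b = a + 1"
      hence "w b = a" using w_w[of a] that by simp
      with ab(2) \<open>b = a + 1\<close> show False by (auto simp: fixed_points_def adjacent_openers_def)
    qed
    with ab show "w a < w b" by (auto simp: fixed_points_def adjacent_openers_def)
  qed
  have "fixed_points \<inter> adjacent_openers = {}" by (auto simp: fixed_points_def adjacent_openers_def)
  thus "card (fixed_points \<union> adjacent_openers) = n - 2 * card openers + card adjacent_openers"
    using finite_sets card_fixed_points by (simp add: card_Un_disjoint)
qed

text \<open>If the value after an opener \<open>a\<close> were larger than \<open>w a\<close>, the cycle of \<open>a + 1\<close> would start inside the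
  cycle of \<open>a\<close> and end outside.\<close>

lemma descent_at_opener:
  assumes "a < w a"
  shows "w (a + 1) < w a"
proof (rule ccontr)
  assume neg: "\<not> w (a + 1) < w a"
  have "w (a + 1) \<noteq> w a" using w_w[of a] w_w[of "a + 1"] by auto
  hence gt: "w a < w (a + 1)" using neg by simp
  have "w a \<noteq> a + 1" using w_w[of a] gt by auto
  hence "a + 1 < w a" using assms by simp
  thus False using no_crossing[of a "a + 1" "w a" "w (a + 1)"] gt by simp
qed

lemma descent_before_closer:
  assumes "w (b + 1) < b + 1"
  shows "w (b + 1) < w b"
proof (rule ccontr)
  let ?x = "w (b + 1)"
  assume neg: "\<not> ?x < w b"
  have "w b \<noteq> ?x" using w_w[of b] w_w[of "b + 1"] by auto
  hence lt: "w b < ?x" using neg by simp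
  have "?x \<noteq> b" using w_w[of "b + 1"] lt assms by auto
  hence "?x < b" using assms by simp
  thus False using no_crossing[of "w b" ?x b "b + 1"] lt w_w by simp
qed

text \<open>The descents after openers and before closers are counted by inclusion and exclusion. A position of both
  kinds belongs to an adjacent cycle, since otherwise the cycles of \<open>a\<close> and \<open>a + 1\<close> would cross.\<close>

lemma few_ascents:
  assumes "n \<ge> 1"
  shows "card {i \<in> {1..<n}. w i < w (i + 1)} < n - 2 * card openers + card adjacent_openers"
proof -
  let ?A = "{i \<in> {1..<n}. w i < w (i + 1)}" and ?D = "{i \<in> {1..<n}. w (i + 1) < w i}"
  define before_closers where "before_closers = {b. w (b + 1) < b + 1}"
  have shift: "closers = Suc ` before_closers"
  proof (intro equalityI subsetI)
    fix b assume b: "b \<in> closers"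
    then obtain b' where "b = Suc b'" by (cases b) (auto simp: closers_def)
    thus "b \<in> Suc ` before_closers" using b by (auto simp: closers_def before_closers_def)
  qed (auto simp: closers_def before_closers_def)
  have card_bc: "card before_closers = card openers"
    using card_closers card_image[of Suc before_closers] unfolding shift by simp
  have fin_bc: "finite before_closers"
    using finite_sets(2) unfolding shift by (rule finite_imageD) simp
  have overlap: "openers \<inter> before_closers = adjacent_openers"
  proof (intro equalityI subsetI)
    fix a assume a: "a \<in> openers \<inter> before_closers"
    show "a \<in> adjacent_openers"
    proof (rule ccontr)
      assume "a \<notin> adjacent_openers"
      hence "a + 1 < w a" using a by (auto simp: openers_def adjacent_openers_def)
      moreover have "w (a + 1) \<noteq> a" using w_w[of "a + 1"] \<open>a + 1 < w a\<close> by auto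
      hence "w (a + 1) < a" using a by (auto simp: before_closers_def)
      ultimately show False using no_crossing[of "w (a + 1)" a "a + 1" "w a"] w_w by simp
    qed
  next
    fix a assume "a \<in> adjacent_openers"
    hence wa: "w a = a + 1" by (simp add: adjacent_openers_def)
    have "w (a + 1) = a" using w_w[of a] unfolding wa .
    with wa show "a \<in> openers \<inter> before_closers" by (simp add: openers_def before_closers_def)
  qed
  have "openers \<union> before_closers \<subseteq> ?D"
  proof
    fix i assume "i \<in> openers \<union> before_closers"
    thus "i \<in> ?D"
    proof
      assume "i \<in> openers"
      hence i: "i < w i" by (simp add: openers_def)
      have "1 \<le> i" "w i \<le> n" using in_range[of i] in_range[of "w i"] i w_w[of i] by auto
      thus ?thesis using i descent_at_opener[OF i] by auto
    next
      assume "i \<in> before_closers"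
      hence i: "w (i + 1) < i + 1" by (simp add: before_closers_def)
      have "i + 1 \<le> n" "1 \<le> w (i + 1)"
        using in_range[of "i + 1"] in_range[of "w (i + 1)"] i w_w[of "i + 1"] by auto
      thus ?thesis using i descent_before_closer[OF i] by auto
    qed
  qed
  hence "card (openers \<union> before_closers) \<le> card ?D" by (intro card_mono) auto
  moreover have "card (openers \<union> before_closers) + card adjacent_openers = 2 * card openers"
    using card_Un_Int[OF finite_sets(1) fin_bc] card_bc overlap by simp
  moreover have "card ?A + card ?D = n - 1"
  proof -
    have "w i \<noteq> w (i + 1)" for i using w_w[of i] w_w[of "i + 1"] by auto
    hence "w i < w (i + 1) \<or> w (i + 1) < w i" for i by (meson linorder_neqE_nat)
    hence split: "{1..<n} = ?A \<union> ?D" by blast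
    have "card (?A \<union> ?D) = card ?A + card ?D" by (rule card_Un_disjoint) auto
    thus ?thesis unfolding split[symmetric] by simp
  qed
  ultimately show ?thesis using card_fixed_points assms by linarith
qed

end

theorem proposition6p5:
  fixes n k c :: nat and w :: "nat \<Rightarrow> nat"
  assumes "n \<ge> 1"
    and "w permutes {1..n}"
    and "noncrossing_involution w"
    and "k = card (two_cycles w)"
    and "c = card {C \<in> two_cycles w. adjacent C}"
  shows "(\<exists>T. is_SD n w T) \<and>
    (\<forall>T. is_SD n w T \<longrightarrow>
       L_shaped T \<and> shape T = (n - 2 * k + c) # replicate (2 * k - c) 1)"
proof (intro conjI allI impI)
  show "\<exists>T. is_SD n w T" by (rule is_SD_exists[OF assms(2)])
  fix T assume SD: "is_SD n w T"
  interpret noncrossing n w by unfold_locales (rule assms(2,3))+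
  have kc: "k = card openers" "c = card adjacent_openers"
    using assms(4,5) by (simp_all add: card_two_cycles card_adjacent)
  have l: "card (fixed_points \<union> adjacent_openers) = n - 2 * k + c"
    using increasing_subsequence(3) by (simp add: kc)
  have few: "card {i \<in> {1..<n}. w i < w (i + 1)} < n - 2 * k + c"
    using few_ascents[OF assms(1)] by (simp add: kc)
  have "shape T = (n - 2 * k + c) # replicate (n - (n - 2 * k + c)) 1"
    using SD_shape_of_long_increasing_subsequence[OF assms(2,1) increasing_subsequence(1,2) _ SD]
      few by (simp only: l)
  moreover have "n - (n - 2 * k + c) = 2 * k - c"
    using card_fixed_points card_adjacent_le kc by linarith
  ultimately show shape: "shape T = (n - 2 * k + c) # replicate (2 * k - c) 1" by simp
  show "L_shaped T" unfolding L_shaped_def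
    by (rule exI[of _ "n - 2 * k + c"], rule exI[of _ "2 * k - c"]) (use shape few in simp)
qed

end
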